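(* Let $A$ be a positive operator with discrete spectrum on the separable Hilbert space $H$, let $0\le\sigma<1$, and let $F:D(A^\sigma)\to H$ satisfy $F(0)=0$ and $\|F(u_1)-F(u_2)\|\le L\|u_1-u_2\|_\sigma$ for all $u_1,u_2\in D(A^\sigma)$, for some $L>0$. Let $v^\alpha(t,\omega_{\ell^\alpha},x)$ be the solution of $\frac{dv^\alpha}{dt}+Av^\alpha=F(v^\alpha)+v^\alpha\diamond\dot W_{S^\alpha_t}$, $v^\alpha(0)=x$, and let $v(t,\omega,x)$ be the solution of $\frac{dv}{dt}+Av=F(v)+v\circ\dot W_t$, $v(0)=x$. Then for every $x\in H^\sigma=D(A^\sigma)$ and every $T>0$, $$\sup_{t\in[0,T]}\|v^\alpha(t,\omega_{\ell^\alpha},x)-v(t,\omega,x)\|_\sigma\to 0\quad\text{in probability as }\alpha\to2 .$$ That is, $v^\alpha(\cdot,\omega_{\ell^\alpha},x)\to v(\cdot,\omega,x)$ in probability as $\alpha\to 2$ in $D([0,T],H^\sigma)$ equipped with the uniform metric $d_U$, and also in $D([0,T],H^\sigma)$ equipped with the Skorokhod metric $d_{J_1}$.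
   Context: **Operator.** $H$ is a separable Hilbert space with norm $\|\cdot\|$. $A$ positive with discrete spectrum means: there is an orthonormal basis $\{e_k\}$ of $H$ with $Ae_k=\lambda_ke_k$, $0<\lambda_1\le\lambda_2\le\cdots$, $\lambda_k\to+\infty$. $H^\sigma=D(A^\sigma)$ is the domain of $A^\sigma$ with norm $\|u\|_\sigma=\|A^\sigma u\|$. **Noise.** $\alpha\in(1,2)$ and $\alpha\to2$ means $\alpha\uparrow2$. $W$ is a two-sided one-dimensional standard Brownian motion with path $\omega\in\mathbb W$ ($\mathbb W$: continuous functions $\mathbb R\to\mathbb R$ vanishing at $0$, with Wiener measure $\mu_{\mathbb W}$). $S^\alpha$ is a two-sided $\frac\alpha2$-stable subordinator independent of $W$, with path $\ell^\alpha\in\mathbb S$ ($\mathbb S$: increasing càdlàg functions $\mathbb R\to\mathbb R$ with limit $0$ at $0$), law $\mu_{\mathbb S}$, no drift, and Lévy measure $C(\alpha)\,x^{-1-\alpha/2}dx$ on $(0,\infty)$, where $C(\alpha)>0$ and $\lim_{\alpha\to2}\frac{2C(\alpha)}{2-\alpha}=1$. The space is $\Omega=\mathbb W\times\mathbb S$ with $\mathbb P=\mu_{\mathbb W}\times\mu_{\mathbb S}$; an element $(\omega,\ell^\alpha)$ is written $\omega_{\ell^\alpha}$, and $L^\alpha_t=W_{S^\alpha_t}=\omega_{\ell^\alpha_t}$ is the subordinated Brownian motion. The same $\omega$ drives both equations. $\Omega$ is restricted to a shift-invariant set of full measure on which $\omega_{\ell^\alpha_t}/t\to0$ and $\omega_t/t\to0$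 as $t\to\pm\infty$. "In probability as $\alpha\to2$" means that for each $\varepsilon>0$ the $\mathbb P$-probability that the quantity exceeds $\varepsilon$ tends to $0$. **Ornstein–Uhlenbeck processes.** $z(\theta_t\omega_{\ell^\alpha})=\omega_{\ell^\alpha_t}-\int_{-\infty}^0e^s\omega_{\ell^\alpha_{t+s}}ds$ and $z(\theta_t\omega)=\omega_t-\int_{-\infty}^0e^s\omega_{t+s}ds$ (stationary solutions of $dz=-z\,dt+dW_{S^\alpha_t}$ and $dz=-z\,dt+dW_t$); $\theta_0$ is the identity. **Solutions.** $\diamond$ is the Marcus integral and $\circ$ the Stratonovich integral. The solutions are given by $v^\alpha(t,\omega_{\ell^\alpha},x)=e^{z(\theta_t\omega_{\ell^\alpha})}u^\alpha(t,\omega_{\ell^\alpha},e^{-z(\omega_{\ell^\alpha})}x)$ and $v(t,\omega,x)=e^{z(\theta_t\omega)}u(t,\omega,e^{-z(\omega)}x)$, where $u^\alpha(\cdot,\omega_{\ell^\alpha},y)$ is the solution with initial value $y$ at $t=0$ (in the variation-of-constants sense) of $\frac{du^\alpha}{dt}+Au^\alpha=z(\theta_t\omega_{\ell^\alpha})u^\alpha+G(\theta_t\omega_{\ell^\alpha},u^\alpha)$ with $G(\omega_{\ell^\alpha},u)=e^{-z(\omega_{\ell^\alpha})}F(e^{z(\omega_{\ell^\alpha})}u)$, i.e. $$u^\alpha(t)=e^{-At+\int_0^tz(\theta_r\omega_{\ell^\alpha})dr}y+\int_0^te^{-A(t-s)+\int_s^tz(\theta_r\omega_{\ell^\alpha})dr}G(\theta_s\omega_{\ell^\alpha},u^\alpha(s))ds,\quad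 t\ge 0,$$ and $u(\cdot,\omega,y)$ is defined in the same way with $\omega$ in place of $\omega_{\ell^\alpha}$. **Path space.** $D([0,T],H^\sigma)$ is the space of càdlàg $H^\sigma$-valued functions on $[0,T]$; $d_U$ is the uniform metric; $d_{J_1}(\varphi_1,\varphi_2)=\inf_{\lambda\in\Lambda}\{\sup_{0\le t\le T}\|\varphi_1(t)-\varphi_2(\lambda(t))\|_\sigma+\sup_{s\ne t\in[0,T]}|\log\frac{\lambda(s)-\lambda(t)}{s-t}|\}$, where $\Lambda$ is the set of strictly increasing continuous maps of $[0,T]$ onto itself. *)

theory Defs
  imports "HOL-Probability.Probability"
begin

section \<open>Operators with discrete spectrum\<close>

text \<open>
  A separable Hilbert space is a type of class
  \<open>{real_inner, banach, second_countable_topology}\<close>. An unbounded operator is a map \<open>A\<close> together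
  with its domain \<open>DA\<close>; values of \<open>A\<close> outside \<open>DA\<close> are irrelevant. Eigenvalues are indexed from 0.
\<close>

definition orthonormal_basis :: "(nat \<Rightarrow> 'h::real_inner) \<Rightarrow> bool" where
  "orthonormal_basis e \<longleftrightarrow>
     (\<forall>i j. e i \<bullet> e j = (if i = j then 1 else 0)) \<and> closure (span (range e)) = UNIV"

text \<open>
  \<open>A\<close> equals its adjoint: \<open>u\<close> lies in the domain of the adjoint, with value \<open>w\<close>, iff it lies in
  the domain of \<open>A\<close> with value \<open>w\<close>. For a densely defined \<open>A\<close> this entails linearity.
\<close>
definition selfadjoint_on :: "'h::real_inner set \<Rightarrow> ('h \<Rightarrow> 'h) \<Rightarrow> bool" where
  "selfadjoint_on DA A \<longleftrightarrow>
     (\<forall>u w. (u \<in> DA \<and> A u = w) \<longleftrightarrow> (\<forall>v\<in>DA. A v \<bullet> u = v \<bullet> w))"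

definition positive_discrete_spectrum ::
  "'h::real_inner set \<Rightarrow> ('h \<Rightarrow> 'h) \<Rightarrow> (nat \<Rightarrow> 'h) \<Rightarrow> (nat \<Rightarrow> real) \<Rightarrow> bool" where
  "positive_discrete_spectrum DA A e lam \<longleftrightarrow>
     selfadjoint_on DA A \<and> orthonormal_basis e \<and>
     (\<forall>k. e k \<in> DA \<and> A (e k) = lam k *\<^sub>R e k) \<and>
     0 < lam 0 \<and> incseq lam \<and> filterlim lam at_top sequentially"

text \<open>The powers \<open>A\<^sup>\<sigma>\<close> and the semigroup \<open>exp (-A t)\<close>, through the spectral decomposition of \<open>A\<close>.\<close>

definition frac_dom :: "(nat \<Rightarrow> 'h::real_inner) \<Rightarrow> (nat \<Rightarrow> real) \<Rightarrow> real \<Rightarrow> 'h set" where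
  "frac_dom e lam \<sigma> = {u. summable (\<lambda>k. (lam k powr \<sigma> * (u \<bullet> e k))\<^sup>2)}"

definition frac_pow ::
  "(nat \<Rightarrow> 'h::real_inner) \<Rightarrow> (nat \<Rightarrow> real) \<Rightarrow> real \<Rightarrow> 'h \<Rightarrow> 'h" where
  "frac_pow e lam \<sigma> u = (\<Sum>k. (lam k powr \<sigma> * (u \<bullet> e k)) *\<^sub>R e k)"

definition frac_norm ::
  "(nat \<Rightarrow> 'h::real_inner) \<Rightarrow> (nat \<Rightarrow> real) \<Rightarrow> real \<Rightarrow> 'h \<Rightarrow> real" where
  "frac_norm e lam \<sigma> u = norm (frac_pow e lam \<sigma> u)"

definition semigroup_exp ::
  "(nat \<Rightarrow> 'h::real_inner) \<Rightarrow> (nat \<Rightarrow> real) \<Rightarrow> real \<Rightarrow> 'h \<Rightarrow> 'h" where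
  "semigroup_exp e lam t u = (\<Sum>k. (exp (- lam k * t) * (u \<bullet> e k)) *\<^sub>R e k)"


section \<open>Noise\<close>

definition path_algebra :: "(real \<Rightarrow> real) set \<Rightarrow> (real \<Rightarrow> real) measure" where
  "path_algebra X = restrict_space (PiM UNIV (\<lambda>_. borel)) X"

definition wiener_paths :: "(real \<Rightarrow> real) set" where
  "wiener_paths = {\<omega>. continuous_on UNIV \<omega> \<and> \<omega> 0 = 0}"

text \<open>Left limits of an increasing function exist automatically.\<close>
definition subordinator_paths :: "(real \<Rightarrow> real) set" where
  "subordinator_paths =
     {ell. mono ell \<and> (\<forall>t. continuous (at_right t) ell) \<and> (ell \<longlongrightarrow> 0) (at 0)}"

definition independent_increments :: "(real \<Rightarrow> real) measure \<Rightarrow> bool" where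
  "independent_increments \<mu> \<longleftrightarrow>
     (\<forall>t::nat \<Rightarrow> real. strict_mono t \<longrightarrow>
        prob_space.indep_vars \<mu> (\<lambda>_. borel) (\<lambda>i \<xi>. \<xi> (t (Suc i)) - \<xi> (t i)) UNIV)"

text \<open>Law of the two-sided standard Brownian motion.\<close>
definition wiener_measure :: "(real \<Rightarrow> real) measure \<Rightarrow> bool" where
  "wiener_measure \<mu> \<longleftrightarrow>
     prob_space \<mu> \<and> sets \<mu> = sets (path_algebra wiener_paths) \<and>
     independent_increments \<mu> \<and>
     (\<forall>s t. s < t \<longrightarrow>
        distributed \<mu> lborel (\<lambda>\<omega>. \<omega> t - \<omega> s) (\<lambda>y. ennreal (normal_density 0 (sqrt (t - s)) y)))"

text \<open>
  Law of the two-sided subordinator without drift and with Levy measure \<open>c x\<^bsup>-1-a\<^esup> dx\<close> on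
  \<open>(0,\<infinity>)\<close>, where \<open>0 < a < 1\<close> is the index of stability (so \<open>a = \<alpha> / 2\<close> below). Drift and Levy
  measure are read off from the Levy--Khintchine formula for the Laplace transform.
\<close>
definition stable_subordinator_measure ::
  "real \<Rightarrow> real \<Rightarrow> (real \<Rightarrow> real) measure \<Rightarrow> bool" where
  "stable_subordinator_measure a c \<mu> \<longleftrightarrow>
     prob_space \<mu> \<and> sets \<mu> = sets (path_algebra subordinator_paths) \<and>
     independent_increments \<mu> \<and>
     (\<forall>s t q. s < t \<longrightarrow> 0 \<le> q \<longrightarrow>
        (LINT ell|\<mu>. exp (- q * (ell t - ell s))) =
        exp (- (t - s) * (LBINT y:{0<..}. (1 - exp (- q * y)) * (c * y powr (- 1 - a)))))"

text \<open>Pairs \<open>(\<omega>, ell)\<close> for which both driving paths \<open>\<omega> \<circ> ell\<close> and \<open>\<omega>\<close> have sublinear growth.\<close>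
definition sublinear_paths :: "((real \<Rightarrow> real) \<times> (real \<Rightarrow> real)) set" where
  "sublinear_paths =
     {(\<omega>, ell). \<omega> \<in> wiener_paths \<and> ell \<in> subordinator_paths \<and>
        ((\<lambda>t. \<omega> (ell t) / t) \<longlongrightarrow> 0) at_top \<and> ((\<lambda>t. \<omega> (ell t) / t) \<longlongrightarrow> 0) at_bot \<and>
        ((\<lambda>t. \<omega> t / t) \<longlongrightarrow> 0) at_top \<and> ((\<lambda>t. \<omega> t / t) \<longlongrightarrow> 0) at_bot}"


section \<open>Solutions\<close>

text \<open>
  Everything depends on the noise only through the driving path \<open>\<xi>\<close>, which is \<open>\<omega> \<circ> ell\<close> for the
  Marcus equation and \<open>\<omega>\<close> for the Stratonovich equation. \<open>ou_process \<xi> t\<close> is \<open>z (\<theta>\<^sub>t \<xi>)\<close>.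
\<close>
definition ou_process :: "(real \<Rightarrow> real) \<Rightarrow> real \<Rightarrow> real" where
  "ou_process \<xi> t = \<xi> t - (LBINT s:{..0}. exp s * \<xi> (t + s))"

definition conj_nonlinearity ::
  "('h::real_vector \<Rightarrow> 'h) \<Rightarrow> (real \<Rightarrow> real) \<Rightarrow> real \<Rightarrow> 'h \<Rightarrow> 'h" where
  "conj_nonlinearity F \<xi> t u =
     exp (- ou_process \<xi> t) *\<^sub>R F (exp (ou_process \<xi> t) *\<^sub>R u)"

text \<open>
  Solutions of the conjugated equation in the variation-of-constants sense, in the usual class of
  continuous functions from \<open>[0,\<infinity>)\<close> to \<open>H\<^sup>\<sigma>\<close>.
\<close>
definition mild_solution ::
  "(nat \<Rightarrow> 'h::{real_inner, banach, second_countable_topology}) \<Rightarrow> (nat \<Rightarrow> real) \<Rightarrow> real \<Rightarrow>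
   ('h \<Rightarrow> 'h) \<Rightarrow> (real \<Rightarrow> real) \<Rightarrow> 'h \<Rightarrow> (real \<Rightarrow> 'h) \<Rightarrow> bool" where
  "mild_solution e lam \<sigma> F \<xi> y u \<longleftrightarrow>
     (\<forall>t\<ge>0. u t \<in> frac_dom e lam \<sigma>) \<and>
     (\<forall>t\<ge>0. ((\<lambda>s. frac_norm e lam \<sigma> (u s - u t)) \<longlongrightarrow> 0) (at t within {0..})) \<and>
     (\<forall>t\<ge>0. u t =
        exp (LBINT r:{0..t}. ou_process \<xi> r) *\<^sub>R semigroup_exp e lam t y +
        (LBINT s:{0..t}. exp (LBINT r:{s..t}. ou_process \<xi> r) *\<^sub>R
           semigroup_exp e lam (t - s) (conj_nonlinearity F \<xi> s (u s))))"

text \<open>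
  Solutions of the stochastic equation (Marcus or Stratonovich, according to \<open>\<xi>\<close>) with initial
  value \<open>x\<close>, obtained by undoing the conjugation.
\<close>
definition sde_solution ::
  "(nat \<Rightarrow> 'h::{real_inner, banach, second_countable_topology}) \<Rightarrow> (nat \<Rightarrow> real) \<Rightarrow> real \<Rightarrow>
   ('h \<Rightarrow> 'h) \<Rightarrow> (real \<Rightarrow> real) \<Rightarrow> 'h \<Rightarrow> (real \<Rightarrow> 'h) \<Rightarrow> bool" where
  "sde_solution e lam \<sigma> F \<xi> x v \<longleftrightarrow>
     (\<exists>u. mild_solution e lam \<sigma> F \<xi> (exp (- ou_process \<xi> 0) *\<^sub>R x) u \<and>
          (\<forall>t\<ge>0. v t = exp (ou_process \<xi> t) *\<^sub>R u t))"


section \<open>Path space and convergence in probability\<close>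

text \<open>Membership depends only on the restriction to \<open>[0,T]\<close>; limits are in the norm of \<open>H\<^sup>\<sigma>\<close>.\<close>
definition cadlag_space ::
  "(nat \<Rightarrow> 'h::real_inner) \<Rightarrow> (nat \<Rightarrow> real) \<Rightarrow> real \<Rightarrow> real \<Rightarrow> (real \<Rightarrow> 'h) set" where
  "cadlag_space e lam \<sigma> T =
     {\<phi>. (\<forall>t\<in>{0..T}. \<phi> t \<in> frac_dom e lam \<sigma>) \<and>
         (\<forall>t\<in>{0..<T}. ((\<lambda>s. frac_norm e lam \<sigma> (\<phi> s - \<phi> t)) \<longlongrightarrow> 0) (at_right t)) \<and>
         (\<forall>t\<in>{0<..T}. \<exists>l\<in>frac_dom e lam \<sigma>.
            ((\<lambda>s. frac_norm e lam \<sigma> (\<phi> s - l)) \<longlongrightarrow> 0) (at_left t))}"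

text \<open>
  The distances take values in \<open>ennreal\<close> because a time change may have an infinite logarithmic
  slope, and a supremum over an unbounded set of reals carries no information.
\<close>
definition uniform_dist ::
  "(nat \<Rightarrow> 'h::real_inner) \<Rightarrow> (nat \<Rightarrow> real) \<Rightarrow> real \<Rightarrow> real \<Rightarrow>
   (real \<Rightarrow> 'h) \<Rightarrow> (real \<Rightarrow> 'h) \<Rightarrow> ennreal" where
  "uniform_dist e lam \<sigma> T \<phi> \<psi> = (SUP t\<in>{0..T}. ennreal (frac_norm e lam \<sigma> (\<phi> t - \<psi> t)))"

definition time_changes :: "real \<Rightarrow> (real \<Rightarrow> real) set" where
  "time_changes T =
     {h. strict_mono_on {0..T} h \<and> continuous_on {0..T} h \<and> h ` {0..T} = {0..T}}"

definition skorokhod_dist ::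
  "(nat \<Rightarrow> 'h::real_inner) \<Rightarrow> (nat \<Rightarrow> real) \<Rightarrow> real \<Rightarrow> real \<Rightarrow>
   (real \<Rightarrow> 'h) \<Rightarrow> (real \<Rightarrow> 'h) \<Rightarrow> ennreal" where
  "skorokhod_dist e lam \<sigma> T \<phi> \<psi> =
     (INF h\<in>time_changes T.
        (SUP t\<in>{0..T}. ennreal (frac_norm e lam \<sigma> (\<phi> t - \<psi> (h t)))) +
        (SUP (s, t)\<in>{(s, t). s \<in> {0..T} \<and> t \<in> {0..T} \<and> s \<noteq> t}.
           ennreal \<bar>ln ((h s - h t) / (s - t))\<bar>))"

text \<open>
  \<open>X \<alpha>\<close> tends to 0 in probability as \<open>\<alpha>\<close> increases to 2, where the probability space depends
  on \<open>\<alpha>\<close> and has been restricted to the set \<open>\<Omega> \<alpha>\<close>. The outer measure agrees with \<open>P \<alpha>\<close> on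
  measurable events; it is used because \<open>measure\<close> is 0 on every nonmeasurable event.
\<close>
definition null_in_probability ::
  "(real \<Rightarrow> 'p measure) \<Rightarrow> (real \<Rightarrow> 'p set) \<Rightarrow> (real \<Rightarrow> 'p \<Rightarrow> ennreal) \<Rightarrow> bool" where
  "null_in_probability P \<Omega> X \<longleftrightarrow>
     (\<forall>\<epsilon>>0. ((\<lambda>\<alpha>. outer_measure_of (P \<alpha>) {p \<in> \<Omega> \<alpha>. X \<alpha> p > ennreal \<epsilon>}) \<longlongrightarrow> 0) (at_left 2))"

end

theory Submission
  imports Defs
begin

text \<open>
  Undoing the Ornstein--Uhlenbeck conjugation, the multiplier \<open>exp (z\<^sub>t - z\<^sub>s + \<integral>\<^sub>s\<^sup>t z)\<close> collapses to
  \<open>exp (\<xi>\<^sub>t - \<xi>\<^sub>s)\<close>, where \<open>\<xi>\<close> is the driving path, because \<open>dz = - z dt + d\<xi>\<close>. Hence both solutions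
  satisfy \<open>v(t) = e\<^bsup>\<xi>(t)\<^esup> e\<^bsup>-At\<^esup> x + \<integral>\<^sub>0\<^sup>t e\<^bsup>\<xi>(t)-\<xi>(s)\<^esup> e\<^bsup>-A(t-s)\<^esup> F(v(s)) ds\<close>, in which the noise
  enters only through \<open>\<xi>\<close> on \<open>[0,T]\<close>. The smoothing bound \<open>\<parallel>A\<^sup>\<sigma> e\<^bsup>-Ar\<^esup>\<parallel> \<le> r\<^bsup>-\<sigma>\<^esup>\<close> makes this equation
  a contraction in a norm weighted by \<open>e\<^bsup>-\<beta>t\<^esup>\<close>, so \<open>v\<close> is Lipschitz in \<open>\<xi>\<close> for the uniform norm, with
  a constant depending only on a bound for \<open>\<xi>\<close>. As \<open>\<alpha> \<rightarrow> 2\<close> the Laplace exponent of the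
  subordinator tends to \<open>q\<close>, so \<open>S\<^sub>t \<rightarrow> t\<close> in probability, uniformly on \<open>[0,T]\<close> by monotonicity, and
  uniform continuity of \<open>\<omega>\<close> gives \<open>\<omega> \<circ> ell \<rightarrow> \<omega>\<close> uniformly in probability.
\<close>

section \<open>Fractional powers and the semigroup\<close>

text \<open>The conjugated equations are not compared with each other: z at time t averages the
  driving path over its whole past, and nothing makes \<open>\<omega> \<circ> ell\<close> uniformly
  close to \<open>\<omega>\<close> on (-\<infinity>, 0]. Multiplying back by e^z before comparing
  removes the past; the growth condition at -\<infinity> then only serves to make z well defined.
  Solutions are given, so the contraction constructs nothing: it is an inequality between two
  solutions already known to be bounded. The Lipschitz constant depends on a bound for the paths,
  and Brownian paths have no deterministic bound, so closeness is shown off small exceptional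
  events. These are fixed sets of paths, two in Wiener space and one in subordinator space, chosen
  before \<alpha>; only the law of the subordinator varies. They are measurable and cover the event
  that the distance exceeds \<epsilon>, which is how an outer measure can be estimated.\<close>

locale discrete_spectrum =
  fixes e :: "nat \<Rightarrow> 'h::{real_inner, banach, second_countable_topology}" and lam :: "nat \<Rightarrow> real"
  assumes inner_e: "e i \<bullet> e j = (if i = j then 1 else 0)"
    and lam_pos: "0 < lam k"
begin

section \<open>Orthonormal expansions and the norm of the fractional power space\<close>

lemma norm_sum_e: "finite I \<Longrightarrow> (norm (\<Sum>k\<in>I. c k *\<^sub>R e k))\<^sup>2 = (\<Sum>k\<in>I. (c k)\<^sup>2)"
  unfolding power2_norm_eq_inner
  by (simp add: inner_sum_left inner_sum_right inner_e if_distrib sum.delta power2_eq_square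
      cong: if_cong)

lemma bessel: "(\<Sum>k<N. (h \<bullet> e k)\<^sup>2) \<le> (norm h)\<^sup>2"
proof -
  let ?p = "\<Sum>k<N. (h \<bullet> e k) *\<^sub>R e k"
  have "h \<bullet> ?p = (\<Sum>k<N. (h \<bullet> e k)\<^sup>2)"
    by (simp add: inner_sum_right power2_eq_square)
  moreover have "(norm (h - ?p))\<^sup>2 = (norm h)\<^sup>2 - 2 * (h \<bullet> ?p) + (norm ?p)\<^sup>2"
    by (simp add: power2_norm_eq_inner inner_diff_left inner_diff_right inner_commute)
  ultimately show ?thesis
    using norm_sum_e[of "{..<N}" "\<lambda>k. h \<bullet> e k"] zero_le_power2[of "norm (h - ?p)"] by simp
qed

lemma summable_e:
  assumes "summable (\<lambda>k. (c k)\<^sup>2)"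
  shows "summable (\<lambda>k. c k *\<^sub>R e k)"
  unfolding summable_Cauchy
proof (intro allI impI)
  fix \<epsilon> :: real assume "\<epsilon> > 0"
  then obtain N where N: "\<And>m n. m \<ge> N \<Longrightarrow> norm (\<Sum>k=m..<n. (c k)\<^sup>2) < \<epsilon>\<^sup>2"
    using assms unfolding summable_Cauchy by (metis zero_less_power)
  have "norm (\<Sum>k=m..<n. c k *\<^sub>R e k) < \<epsilon>" if "m \<ge> N" for m n
  proof (rule power2_less_imp_less)
    show "(norm (\<Sum>k=m..<n. c k *\<^sub>R e k))\<^sup>2 < \<epsilon>\<^sup>2"
      using N[OF that, of n] by (simp add: norm_sum_e)
  qed (use \<open>\<epsilon> > 0\<close> in simp)
  then show "\<exists>N. \<forall>m\<ge>N. \<forall>n. norm (\<Sum>k=m..<n. c k *\<^sub>R e k) < \<epsilon>" by blast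
qed

lemma inner_suminf_e:
  assumes "summable (\<lambda>k. c k *\<^sub>R e k)"
  shows "(\<Sum>k. c k *\<^sub>R e k) \<bullet> e j = c j"
proof -
  have "(\<Sum>k. c k *\<^sub>R e k) \<bullet> e j = (\<Sum>k. (c k *\<^sub>R e k) \<bullet> e j)"
    using bounded_linear.suminf[OF bounded_linear_inner_left assms, of "e j"] by simp
  also have "\<dots> = (\<Sum>k. if k = j then c j else 0)"
    by (intro suminf_cong) (simp add: inner_e)
  also have "\<dots> = c j" using sums_unique[OF sums_single[of j "\<lambda>_. c j"]] by simp
  finally show ?thesis .
qed

lemma summable_inner_sq: "summable (\<lambda>k. (h \<bullet> e k)\<^sup>2)"
  by (rule summableI_nonneg_bounded[of _ "(norm h)\<^sup>2"]) (use bessel in auto)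

text \<open>The truncation of the unbounded \<open>frac_pow\<close> to the first \<open>N\<close>
  modes. It is bounded and defined on all of H, including vectors not yet known to lie in
  \<open>frac_dom\<close>.\<close>

definition frac_proj :: "real \<Rightarrow> nat \<Rightarrow> 'h \<Rightarrow> 'h" where
  "frac_proj \<sigma> N u = (\<Sum>k<N. (lam k powr \<sigma> * (u \<bullet> e k)) *\<^sub>R e k)"

lemma bounded_linear_frac_proj: "bounded_linear (frac_proj \<sigma> N)"
  unfolding frac_proj_def
  by (intro bounded_linear_sum bounded_linear_compose[OF bounded_linear_scaleR_left]
      bounded_linear_compose[OF bounded_linear_mult_right bounded_linear_inner_left])

text \<open>Reduces estimates in \<open>H\<^sup>\<sigma>\<close> to bounded operators, which commute with the Bochner integral.\<close>
lemma frac_norm_le_iff: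
  "u \<in> frac_dom e lam \<sigma> \<and> frac_norm e lam \<sigma> u \<le> B \<longleftrightarrow> (\<forall>N. norm (frac_proj \<sigma> N u) \<le> B)"
proof
  assume u: "u \<in> frac_dom e lam \<sigma> \<and> frac_norm e lam \<sigma> u \<le> B"
  have sm: "summable (\<lambda>k. (lam k powr \<sigma> * (u \<bullet> e k)) *\<^sub>R e k)"
    using u by (intro summable_e) (simp add: frac_dom_def)
  have "norm (frac_proj \<sigma> N u) \<le> frac_norm e lam \<sigma> u" for N
  proof (rule power2_le_imp_le)
    show "(norm (frac_proj \<sigma> N u))\<^sup>2 \<le> (frac_norm e lam \<sigma> u)\<^sup>2"
      using bessel[where N=N and h="frac_pow e lam \<sigma> u"] inner_suminf_e[OF sm]
      by (simp add: frac_proj_def norm_sum_e frac_norm_def frac_pow_def)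
  qed (simp add: frac_norm_def)
  with u show "\<forall>N. norm (frac_proj \<sigma> N u) \<le> B" by (meson order_trans)
next
  assume B: "\<forall>N. norm (frac_proj \<sigma> N u) \<le> B"
  have sq: "(\<Sum>k<N. (lam k powr \<sigma> * (u \<bullet> e k))\<^sup>2) \<le> B\<^sup>2" for N
    using power_mono[OF B[rule_format, of N], of 2] by (simp add: frac_proj_def norm_sum_e)
  have sm: "summable (\<lambda>k. (lam k powr \<sigma> * (u \<bullet> e k))\<^sup>2)"
    by (rule summableI_nonneg_bounded[OF _ sq]) simp
  have "(\<lambda>N. norm (frac_proj \<sigma> N u)) \<longlonglongrightarrow> frac_norm e lam \<sigma> u"
    unfolding frac_norm_def frac_pow_def frac_proj_def
    by (intro tendsto_norm summable_LIMSEQ summable_e sm)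
  then have "frac_norm e lam \<sigma> u \<le> B"
    by (rule LIMSEQ_le_const2) (use B in auto)
  then show "u \<in> frac_dom e lam \<sigma> \<and> frac_norm e lam \<sigma> u \<le> B"
    using sm by (simp add: frac_dom_def)
qed

lemma norm_frac_proj_le:
  "u \<in> frac_dom e lam \<sigma> \<Longrightarrow> norm (frac_proj \<sigma> N u) \<le> frac_norm e lam \<sigma> u"
  using frac_norm_le_iff[of u \<sigma> "frac_norm e lam \<sigma> u"] by simp

lemma frac_norm_nonneg: "0 \<le> frac_norm e lam \<sigma> u"
  by (simp add: frac_norm_def)

text \<open>The triangle inequality is that of H, applied to each truncation. Membership is carried
  along in all these rules because outside \<open>frac_dom\<close> the series in
  \<open>frac_pow\<close> diverges and \<open>frac_norm\<close> has no meaningful value.\<close>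

lemma frac_norm_add:
  assumes "u \<in> frac_dom e lam \<sigma>" "w \<in> frac_dom e lam \<sigma>"
  shows "u + w \<in> frac_dom e lam \<sigma>"
    and "frac_norm e lam \<sigma> (u + w) \<le> frac_norm e lam \<sigma> u + frac_norm e lam \<sigma> w"
proof -
  have "norm (frac_proj \<sigma> N (u + w)) \<le> frac_norm e lam \<sigma> u + frac_norm e lam \<sigma> w" for N
    using norm_frac_proj_le[OF assms(1), of N] norm_frac_proj_le[OF assms(2), of N]
      norm_triangle_ineq[of "frac_proj \<sigma> N u" "frac_proj \<sigma> N w"]
    by (simp add: linear_add[OF bounded_linear.linear[OF bounded_linear_frac_proj]])
  then show "u + w \<in> frac_dom e lam \<sigma>"
    "frac_norm e lam \<sigma> (u + w) \<le> frac_norm e lam \<sigma> u + frac_norm e lam \<sigma> w"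
    using frac_norm_le_iff[of "u + w"] by auto
qed

lemma frac_norm_scaleR:
  assumes "u \<in> frac_dom e lam \<sigma>"
  shows "c *\<^sub>R u \<in> frac_dom e lam \<sigma>"
    and "frac_norm e lam \<sigma> (c *\<^sub>R u) \<le> \<bar>c\<bar> * frac_norm e lam \<sigma> u"
proof -
  have "norm (frac_proj \<sigma> N (c *\<^sub>R u)) \<le> \<bar>c\<bar> * frac_norm e lam \<sigma> u" for N
    using norm_frac_proj_le[OF assms, of N]
    by (simp add: linear_scale[OF bounded_linear.linear[OF bounded_linear_frac_proj]] mult_left_mono)
  then show "c *\<^sub>R u \<in> frac_dom e lam \<sigma>"
    "frac_norm e lam \<sigma> (c *\<^sub>R u) \<le> \<bar>c\<bar> * frac_norm e lam \<sigma> u"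
    using frac_norm_le_iff[of "c *\<^sub>R u"] by auto
qed

lemma frac_norm_diff:
  assumes "u \<in> frac_dom e lam \<sigma>" "w \<in> frac_dom e lam \<sigma>"
  shows "u - w \<in> frac_dom e lam \<sigma>"
    and "frac_norm e lam \<sigma> (u - w) \<le> frac_norm e lam \<sigma> u + frac_norm e lam \<sigma> w"
  using frac_norm_add[OF assms(1) frac_norm_scaleR(1)[OF assms(2), of "-1"]]
    frac_norm_scaleR(2)[OF assms(2), of "-1"] by auto

lemma frac_dom_zero: "0 \<in> frac_dom e lam \<sigma>" and frac_norm_zero: "frac_norm e lam \<sigma> 0 = 0"
  by (auto simp: frac_dom_def frac_norm_def frac_pow_def)

section \<open>The semigroup: contractivity and smoothing\<close>

lemma summable_semigroup:
  assumes "0 \<le> t"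
  shows "summable (\<lambda>k. (exp (- lam k * t) * (h \<bullet> e k)) *\<^sub>R e k)"
proof (intro summable_e summable_comparison_test'[OF summable_inner_sq[of h]])
  fix k
  have "(exp (- lam k * t))\<^sup>2 \<le> 1"
    using assms lam_pos[of k] by (intro power_le_one) (auto simp: less_imp_le)
  then show "norm ((exp (- lam k * t) * (h \<bullet> e k))\<^sup>2) \<le> (h \<bullet> e k)\<^sup>2"
    by (simp add: power_mult_distrib mult_left_le_one_le)
qed

lemma inner_semigroup:
  "0 \<le> t \<Longrightarrow> semigroup_exp e lam t h \<bullet> e k = exp (- lam k * t) * (h \<bullet> e k)"
  unfolding semigroup_exp_def by (intro inner_suminf_e summable_semigroup)

lemma semigroup_scaleR:
  "0 \<le> t \<Longrightarrow> semigroup_exp e lam t (c *\<^sub>R h) = c *\<^sub>R semigroup_exp e lam t h"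
  unfolding semigroup_exp_def
  using suminf_scaleR_right[OF summable_semigroup, of t c h] by (simp add: mult_ac)

lemma semigroup_diff:
  "0 \<le> t \<Longrightarrow> semigroup_exp e lam t (h - g) = semigroup_exp e lam t h - semigroup_exp e lam t g"
  unfolding semigroup_exp_def
  using suminf_diff[OF summable_semigroup summable_semigroup, of t t h g]
  by (simp add: inner_diff_left algebra_simps)

lemma norm_semigroup_le:
  assumes "0 \<le> t"
  shows "norm (semigroup_exp e lam t h) \<le> norm h"
proof (rule LIMSEQ_le_const2)
  show "(\<lambda>N. norm (\<Sum>k<N. (exp (- lam k * t) * (h \<bullet> e k)) *\<^sub>R e k))
      \<longlonglongrightarrow> norm (semigroup_exp e lam t h)"
    unfolding semigroup_exp_def by (intro tendsto_norm summable_LIMSEQ summable_semigroup assms)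
  have "norm (\<Sum>k<N. (exp (- lam k * t) * (h \<bullet> e k)) *\<^sub>R e k) \<le> norm h" for N
  proof (rule power2_le_imp_le)
    have "(exp (- lam k * t))\<^sup>2 \<le> 1" for k
      using assms lam_pos[of k] by (intro power_le_one) (auto simp: less_imp_le)
    then have "(\<Sum>k<N. (exp (- lam k * t) * (h \<bullet> e k))\<^sup>2) \<le> (\<Sum>k<N. (h \<bullet> e k)\<^sup>2)"
      by (intro sum_mono) (simp add: power_mult_distrib mult_left_le_one_le)
    with bessel[where N=N and h=h] show
      "(norm (\<Sum>k<N. (exp (- lam k * t) * (h \<bullet> e k)) *\<^sub>R e k))\<^sup>2 \<le> (norm h)\<^sup>2"
      by (simp add: norm_sum_e)
  qed simp
  then show "\<exists>M. \<forall>N\<ge>M. norm (\<Sum>k<N. (exp (- lam k * t) * (h \<bullet> e k)) *\<^sub>R e k) \<le> norm h" by blast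
qed

lemma frac_norm_semigroup:
  assumes t: "0 \<le> t" and x: "x \<in> frac_dom e lam \<sigma>"
  shows "semigroup_exp e lam t x \<in> frac_dom e lam \<sigma>"
    and "frac_norm e lam \<sigma> (semigroup_exp e lam t x) \<le> frac_norm e lam \<sigma> x"
proof -
  have "norm (frac_proj \<sigma> N (semigroup_exp e lam t x)) \<le> norm (frac_proj \<sigma> N x)" for N
  proof (rule power2_le_imp_le)
    have "(exp (- lam k * t))\<^sup>2 \<le> 1" for k
      using t lam_pos[of k] by (intro power_le_one) (auto simp: less_imp_le)
    then show "(norm (frac_proj \<sigma> N (semigroup_exp e lam t x)))\<^sup>2 \<le> (norm (frac_proj \<sigma> N x))\<^sup>2"
      unfolding frac_proj_def inner_semigroup[OF t]
      by (simp add: norm_sum_e, intro sum_mono)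
         (simp add: power_mult_distrib mult_left_mono mult_left_le_one_le)
  qed simp
  then have "norm (frac_proj \<sigma> N (semigroup_exp e lam t x)) \<le> frac_norm e lam \<sigma> x" for N
    using norm_frac_proj_le[OF x] order_trans by blast
  then show "semigroup_exp e lam t x \<in> frac_dom e lam \<sigma>"
    "frac_norm e lam \<sigma> (semigroup_exp e lam t x) \<le> frac_norm e lam \<sigma> x"
    using frac_norm_le_iff by blast+
qed

text \<open>On the k-th mode the factor is r^(-\<sigma>) times y^\<sigma> e^(-y) with y =
  \<open>lam k * r\<close>, and y^\<sigma> \<le> (1 + y)^\<sigma> \<le> 1 + y \<le> e^y. The bound
  is uniform in \<open>N\<close>, and its singularity at r = 0 is integrable when \<sigma> <
  1.\<close>

lemma frac_proj_semigroup:
  assumes \<sigma>: "0 \<le> \<sigma>" "\<sigma> \<le> 1" and r: "0 < r"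
  shows "norm (frac_proj \<sigma> N (semigroup_exp e lam r h)) \<le> r powr - \<sigma> * norm h"
proof (rule power2_le_imp_le)
  have bound: "lam k powr \<sigma> * exp (- lam k * r) \<le> r powr - \<sigma>" for k
  proof -
    let ?y = "lam k * r"
    have y: "0 < ?y" using r lam_pos by simp
    have "?y powr \<sigma> \<le> (1 + ?y) powr \<sigma>" using \<sigma> y by (intro powr_mono2) auto
    also have "\<dots> \<le> (1 + ?y) powr 1" using \<sigma> y by (intro powr_mono) auto
    also have "\<dots> \<le> exp ?y" using y exp_ge_add_one_self[of ?y] by simp
    finally have "?y powr \<sigma> * exp (- ?y) \<le> 1" by (simp add: exp_minus field_simps)
    moreover have "?y powr \<sigma> = lam k powr \<sigma> * r powr \<sigma>"
      using r lam_pos[of k] by (simp add: powr_mult)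
    ultimately show ?thesis using r by (simp add: powr_minus field_simps)
  qed
  have "(lam k powr \<sigma> * (exp (- lam k * r) * (h \<bullet> e k)))\<^sup>2
      \<le> (r powr - \<sigma>)\<^sup>2 * (h \<bullet> e k)\<^sup>2" for k
  proof -
    have "(lam k powr \<sigma> * exp (- lam k * r))\<^sup>2 \<le> (r powr - \<sigma>)\<^sup>2"
      by (intro power_mono bound) auto
    from mult_right_mono[OF this zero_le_power2[of "h \<bullet> e k"]]
    show ?thesis by (simp add: power_mult_distrib mult_ac)
  qed
  then have "(\<Sum>k<N. (lam k powr \<sigma> * (exp (- lam k * r) * (h \<bullet> e k)))\<^sup>2)
      \<le> (r powr - \<sigma>)\<^sup>2 * (\<Sum>k<N. (h \<bullet> e k)\<^sup>2)"
    by (subst sum_distrib_left) (intro sum_mono)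
  also have "\<dots> \<le> (r powr - \<sigma>)\<^sup>2 * (norm h)\<^sup>2" by (intro mult_left_mono bessel) auto
  finally show "(norm (frac_proj \<sigma> N (semigroup_exp e lam r h)))\<^sup>2 \<le> (r powr - \<sigma> * norm h)\<^sup>2"
    unfolding frac_proj_def using r by (simp add: norm_sum_e inner_semigroup power_mult_distrib)
qed simp

end

section \<open>Convolution with the semigroup and stability\<close>

text \<open>A bridge from gauge integrals, for which the power functions have closed forms, to
  \<open>lborel\<close>: nonnegativity gives absolute integrability for the completed measure, and
  Borel measurability brings it back.\<close>

lemma set_integrable_lborel_nonneg:
  fixes f :: "real \<Rightarrow> real"
  assumes "f integrable_on S" "\<And>x. x \<in> S \<Longrightarrow> 0 \<le> f x" "f \<in> borel_measurable borel" "S \<in> sets borel"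
  shows "set_integrable lborel S f"
proof -
  have "set_integrable lebesgue S f"
    using assms by (intro nonnegative_absolutely_integrable_1) auto
  moreover have "(\<lambda>x. indicator S x *\<^sub>R f x) \<in> borel_measurable lborel"
    using assms by measurable
  ultimately show ?thesis by (simp add: set_integrable_def integrable_completion)
qed

text \<open>For large \<open>\<beta>\<close> the factor e^(\<beta> s) is small relative to
  e^(\<beta> t) except for s near t, where the kernel has little mass. One \<open>\<beta>\<close>
  serves every t in [0,T], so the later contraction works on the whole interval without cutting it
  into short pieces.\<close>

lemma weighted_kernel_small:
  fixes \<sigma> \<epsilon> T :: real
  assumes \<sigma>: "0 \<le> \<sigma>" "\<sigma> < 1" and \<epsilon>: "0 < \<epsilon>"
  obtains \<beta> where "\<And>t. t \<in> {0..T} \<Longrightarrow>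
        set_integrable lborel {0..t} (\<lambda>s. (t - s) powr - \<sigma> * exp (\<beta> * s))"
    and "\<And>t. t \<in> {0..T} \<Longrightarrow>
        (LBINT s:{0..t}. (t - s) powr - \<sigma> * exp (\<beta> * s)) \<le> \<epsilon> * exp (\<beta> * t)"
proof -
  define f where "f r = indicator {0..T} r * r powr - \<sigma>" for r :: real
  have f_meas: "f \<in> borel_measurable lborel" unfolding f_def by measurable
  have f_exp: "norm (f r * exp (- b * r)) \<le> f r" if "0 \<le> b" for r b
  proof (cases "r \<in> {0..T}")
    case True
    then have "exp (- b * r) \<le> 1" using that by simp
    from mult_left_mono[OF this, of "f r"] True show ?thesis by (simp add: f_def abs_mult)
  qed (simp add: f_def)
  have "set_integrable lborel {0..T} (\<lambda>r. r powr - \<sigma>)"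
  proof (cases "0 \<le> T")
    case True
    then show ?thesis
      using has_integral_powr_from_0[of "- \<sigma>" T] \<sigma>
      by (intro set_integrable_lborel_nonneg) auto
  qed (simp add: set_integrable_def)
  then have f_int: "integrable lborel f"
    by (simp add: set_integrable_def f_def[abs_def])
  \<comment> \<open>The undamped kernel \<open>f\<close> dominates, and damping at rate n sends the
    integrand to 0 for r > 0. At r = 0 the convention that 0 powr anything is 0 gives f 0 =
    0.\<close>
  have "(\<lambda>n. LINT r|lborel. f r * exp (- real n * r)) \<longlonglongrightarrow> (LINT (r::real)|lborel. (0::real))"
  proof (rule Bochner_Integration.integral_dominated_convergence[where w = f])
    show "AE r in lborel. (\<lambda>n. f r * exp (- real n * r)) \<longlonglongrightarrow> 0"
    proof (rule AE_I2)
      fix r :: real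
      show "(\<lambda>n. f r * exp (- real n * r)) \<longlonglongrightarrow> 0"
      proof (cases "0 < r")
        case True
        then have "(\<lambda>n. exp (- real n * r)) \<longlonglongrightarrow> 0" by real_asymp
        then show ?thesis by (intro tendsto_mult_right_zero)
      qed (auto simp: f_def indicator_def)
    qed
    show "AE r in lborel. norm (f r * exp (- real n * r)) \<le> f r" for n
      by (rule AE_I2) (rule f_exp, simp)
  qed (use f_int f_meas in auto)
  then have "(\<lambda>n. LINT r|lborel. f r * exp (- real n * r)) \<longlonglongrightarrow> 0" by simp
  from order_tendstoD(2)[OF this \<epsilon>]
  obtain n where n: "(LINT r|lborel. f r * exp (- real n * r)) < \<epsilon>"
    by (auto simp: eventually_sequentially)
  define \<beta> where "\<beta> = real n"
  have fe_int: "integrable lborel (\<lambda>r. f r * exp (- \<beta> * r))"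
    by (rule Bochner_Integration.integrable_bound[OF f_int])
      (use f_meas f_exp in \<open>auto simp: \<beta>_def intro!: AE_I2 order_trans[OF _ abs_ge_self]\<close>)
  define g where "g t r = indicator {0..t} r * (r powr - \<sigma> * exp (- \<beta> * r))" for t r :: real
  have g: "integrable lborel (g t)" "(LINT r|lborel. g t r) \<le> \<epsilon>" if t: "t \<in> {0..T}" for t
  proof -
    have g_meas: "g t \<in> borel_measurable lborel" unfolding g_def by measurable
    show int: "integrable lborel (g t)"
      by (rule Bochner_Integration.integrable_bound[OF fe_int])
        (use t g_meas in \<open>auto simp: f_def g_def indicator_def abs_mult\<close>)
    have "(LINT r|lborel. g t r) \<le> (LINT r|lborel. f r * exp (- \<beta> * r))"
      by (intro integral_mono int fe_int) (use t in \<open>auto simp: f_def g_def indicator_def\<close>)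
    with n show "(LINT r|lborel. g t r) \<le> \<epsilon>" by (simp add: \<beta>_def)
  qed
  \<comment> \<open>The reflection s \<mapsto> t - s, written in affine form for the change of
    variables, splits off e^(\<beta> t) and leaves the damped kernel.\<close>
  have eq: "indicator {0..t} s *\<^sub>R ((t - s) powr - \<sigma> * exp (\<beta> * s))
      = exp (\<beta> * t) * g t (t + (- 1) * s)" for s t
  proof -
    have "exp (\<beta> * s) = exp (\<beta> * t) * exp (- \<beta> * (t - s))"
      by (simp add: exp_add[symmetric] algebra_simps)
    then show ?thesis by (auto simp: g_def indicator_def)
  qed
  show thesis
  proof (rule that)
    fix t assume t: "t \<in> {0..T}"
    show "set_integrable lborel {0..t} (\<lambda>s. (t - s) powr - \<sigma> * exp (\<beta> * s))"
      unfolding set_integrable_def eq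
      by (intro integrable_mult_right lborel_integrable_real_affine g t) simp
    have "(LINT r|lborel. g t r) = (LINT s|lborel. g t (t + (- 1) * s))"
      using lborel_integral_real_affine[of "-1" "g t" t] by simp
    with g(2)[OF t] show "(LBINT s:{0..t}. (t - s) powr - \<sigma> * exp (\<beta> * s)) \<le> \<epsilon> * exp (\<beta> * t)"
      unfolding set_lebesgue_integral_def eq by (simp only: integral_mult_right_zero mult.commute[of \<epsilon>]) (intro mult_left_mono, auto)
  qed
qed

context discrete_spectrum
begin

text \<open>Two estimates with separate roles: contractivity on H makes the Bochner integral exist,
  and smoothing, applied to the truncations under the integral sign, places its value in the domain
  of A^\<sigma> with the weighted bound.\<close>

lemma semigroup_convolution:
  fixes g :: "real \<Rightarrow> 'h"
  assumes \<sigma>: "0 \<le> \<sigma>" "\<sigma> \<le> 1" and t: "0 \<le> t" and M: "0 \<le> M"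
    and meas: "set_borel_measurable lborel {0..t} g"
    and bd: "\<And>s. s \<in> {0..t} \<Longrightarrow> norm (g s) \<le> M * exp (\<beta> * s)"
    and k_int: "set_integrable lborel {0..t} (\<lambda>s. (t - s) powr - \<sigma> * exp (\<beta> * s))"
    and k_le: "(LBINT s:{0..t}. (t - s) powr - \<sigma> * exp (\<beta> * s)) \<le> \<kappa> * exp (\<beta> * t)"
  shows "set_integrable lborel {0..t} (\<lambda>s. semigroup_exp e lam (t - s) (g s))"
    and "(LBINT s:{0..t}. semigroup_exp e lam (t - s) (g s)) \<in> frac_dom e lam \<sigma>"
    and "frac_norm e lam \<sigma> (LBINT s:{0..t}. semigroup_exp e lam (t - s) (g s))
           \<le> M * \<kappa> * exp (\<beta> * t)"
proof -
  let ?h = "\<lambda>s. indicator {0..t} s *\<^sub>R semigroup_exp e lam (t - s) (g s)"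
  \<comment> \<open>With the indicator moved into the coefficients the integrand is a countable sum
    of measurable functions, which settles its measurability.\<close>
  have "?h s = (\<Sum>k. (exp (- lam k * (t - s)) * ((indicator {0..t} s *\<^sub>R g s) \<bullet> e k)) *\<^sub>R e k)" for s
    by (auto simp: indicator_def semigroup_exp_def)
  moreover have "(\<lambda>s. \<Sum>k. (exp (- lam k * (t - s)) * ((indicator {0..t} s *\<^sub>R g s) \<bullet> e k)) *\<^sub>R e k)
      \<in> borel_measurable lborel"
    using meas unfolding set_borel_measurable_def by measurable
  ultimately have h_meas: "?h \<in> borel_measurable lborel" by simp
  have dom: "set_integrable lborel {0..t} (\<lambda>s. M * exp (\<beta> * s))"
    by (intro borel_integrable_atLeastAtMost' continuous_intros)
  show int: "set_integrable lborel {0..t} (\<lambda>s. semigroup_exp e lam (t - s) (g s))"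
  proof (rule set_integrable_bound[OF dom])
    show "set_borel_measurable lborel {0..t} (\<lambda>s. semigroup_exp e lam (t - s) (g s))"
      using h_meas by (simp add: set_borel_measurable_def)
    have "norm (semigroup_exp e lam (t - s) (g s)) \<le> norm (M * exp (\<beta> * s))" if "s \<in> {0..t}" for s
      using norm_semigroup_le[of "t - s" "g s"] bd[OF that] M that by (simp add: abs_mult)
    then show "AE s in lborel. s \<in> {0..t} \<longrightarrow>
        norm (semigroup_exp e lam (t - s) (g s)) \<le> norm (M * exp (\<beta> * s))" by auto
  qed
  have h_int: "integrable lborel ?h" using int by (simp add: set_integrable_def)
  let ?k = "\<lambda>s. M * (indicator {0..t} s *\<^sub>R ((t - s) powr - \<sigma> * exp (\<beta> * s)))"
  have "norm (frac_proj \<sigma> N (LINT s|lborel. ?h s)) \<le> M * \<kappa> * exp (\<beta> * t)" for N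
  proof -
    note bl = bounded_linear_frac_proj[of \<sigma> N]
    have "norm (frac_proj \<sigma> N (LINT s|lborel. ?h s)) = norm (LINT s|lborel. frac_proj \<sigma> N (?h s))"
      by (simp add: integral_bounded_linear[OF bl h_int])
    also have "\<dots> \<le> (LINT s|lborel. norm (frac_proj \<sigma> N (?h s)))" by (rule integral_norm_bound)
    also have "\<dots> \<le> (LINT s|lborel. ?k s)"
    proof (rule integral_mono_AE)
      show "integrable lborel (\<lambda>s. norm (frac_proj \<sigma> N (?h s)))"
        by (intro integrable_norm integrable_bounded_linear[OF bl] h_int)
      show "integrable lborel ?k"
        using k_int by (intro integrable_mult_right) (simp add: set_integrable_def)
      \<comment> \<open>Smoothing requires t - s > 0; the excluded point s = t is a null
        set.\<close>
      have "norm (frac_proj \<sigma> N (?h s)) \<le> ?k s" if "s \<noteq> t" for s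
      proof (cases "s \<in> {0..t}")
        case True
        with that have "norm (frac_proj \<sigma> N (?h s)) \<le> (t - s) powr - \<sigma> * norm (g s)"
          using frac_proj_semigroup[OF \<sigma>, of "t - s" N "g s"] by simp
        also have "\<dots> \<le> (t - s) powr - \<sigma> * (M * exp (\<beta> * s))"
          by (intro mult_left_mono bd True) auto
        finally show ?thesis using True by (simp add: mult_ac)
      qed (simp add: linear_0[OF bounded_linear.linear[OF bl]])
      then show "AE s in lborel. norm (frac_proj \<sigma> N (?h s)) \<le> ?k s"
        by (rule eventually_mono[OF AE_lborel_singleton[of t]])
    qed
    also have "\<dots> \<le> M * (\<kappa> * exp (\<beta> * t))"
      using k_le M unfolding set_lebesgue_integral_def
      by (simp only: integral_mult_right_zero) (intro mult_left_mono)
    finally show ?thesis by (simp add: mult_ac)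
  qed
  then show "(LBINT s:{0..t}. semigroup_exp e lam (t - s) (g s)) \<in> frac_dom e lam \<sigma>"
    "frac_norm e lam \<sigma> (LBINT s:{0..t}. semigroup_exp e lam (t - s) (g s)) \<le> M * \<kappa> * exp (\<beta> * t)"
    unfolding set_lebesgue_integral_def using frac_norm_le_iff by blast+
qed

end

text \<open>The map M \<mapsto> a + M / 2 has fixed point 2 a, and iterating \<open>step\<close>
  from the crude bound \<open>B\<close> approaches it geometrically. This is the uniqueness half of
  a contraction argument, stated for a function known to be bounded.\<close>

lemma weighted_sup_closure:
  fixes \<phi> :: "real \<Rightarrow> real"
  assumes a: "0 \<le> a" and B: "0 \<le> B" and bdd: "\<And>s. s \<in> {0..T} \<Longrightarrow> \<phi> s \<le> B"
    and step: "\<And>M t. 0 \<le> M \<Longrightarrow> (\<And>s. s \<in> {0..T} \<Longrightarrow> \<phi> s \<le> M * exp (\<beta> * s)) \<Longrightarrow>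
          t \<in> {0..T} \<Longrightarrow> \<phi> t \<le> (a + M / 2) * exp (\<beta> * t)"
    and t: "t \<in> {0..T}"
  shows "\<phi> t \<le> 2 * a * exp (\<beta> * t)"
proof -
  \<comment> \<open>The explicit solution of M (n + 1) = a + M n / 2. The exponential factor turns
    the unweighted bound \<open>B\<close> into a weighted one whatever the sign of
    \<open>\<beta>\<close>.\<close>
  define M where "M n = 2 * a + B * exp (\<bar>\<beta>\<bar> * T) / 2 ^ n" for n :: nat
  have iter: "\<phi> s \<le> M n * exp (\<beta> * s)" if "s \<in> {0..T}" for n s
    using that
  proof (induction n arbitrary: s)
    case 0
    have "- (\<beta> * s) \<le> \<bar>\<beta>\<bar> * T"
      using 0 mult_mono[of "\<bar>\<beta>\<bar>" "\<bar>\<beta>\<bar>" s T] abs_ge_minus_self[of "\<beta> * s"] by (auto simp: abs_mult)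
    then have "1 \<le> exp (\<bar>\<beta>\<bar> * T) * exp (\<beta> * s)" by (simp flip: exp_add)
    from mult_left_mono[OF this B] bdd[OF 0] a show ?case
      by (simp add: M_def distrib_right mult.assoc add_increasing)
  next
    case (Suc n)
    have "a + M n / 2 = M (Suc n)" by (simp add: M_def add_divide_distrib)
    moreover have "0 \<le> M n" using a B by (simp add: M_def)
    ultimately show ?case using step[OF _ Suc.IH Suc.prems] by simp
  qed
  have "(\<lambda>n. M n * exp (\<beta> * t)) \<longlonglongrightarrow> 2 * a * exp (\<beta> * t)"
    unfolding M_def by real_asymp
  then show ?thesis by (rule LIMSEQ_le_const) (use iter[OF t] in auto)
qed

lemma abs_exp_diff_le:
  fixes a b c :: real
  assumes "a \<le> c" "b \<le> c"
  shows "\<bar>exp a - exp b\<bar> \<le> exp c * \<bar>a - b\<bar>"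
proof -
  have *: "exp y - exp x \<le> exp c * (y - x)" if "x \<le> y" "y \<le> c" for x y :: real
  proof -
    have "exp y - exp x = exp y * (1 - exp (x - y))" by (simp add: algebra_simps flip: exp_add)
    also have "\<dots> \<le> exp y * (y - x)"
    proof (rule mult_left_mono)
      show "1 - exp (x - y) \<le> y - x" using exp_ge_add_one_self[of "x - y"] by linarith
    qed simp
    also have "\<dots> \<le> exp c * (y - x)" using that by (intro mult_right_mono) auto
    finally show ?thesis .
  qed
  show ?thesis using *[of a b] *[of b a] assms by (cases "a \<le> b") (auto simp: abs_if)
qed

section \<open>Lipschitz dependence of the solution on the driving path\<close>

context discrete_spectrum
begin

text \<open>
  The variation-of-constants formula for the original unknown. Its multiplier is an increment of
  the driving path, because the stationary process cancels (see \<open>ou_process_increment\<close>).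
\<close>
definition duhamel_solution ::
  "real \<Rightarrow> ('h \<Rightarrow> 'h) \<Rightarrow> real \<Rightarrow> (real \<Rightarrow> real) \<Rightarrow> 'h \<Rightarrow> (real \<Rightarrow> 'h) \<Rightarrow> bool" where
  "duhamel_solution \<sigma> F T \<xi> x V \<longleftrightarrow>
     (\<forall>t\<in>{0..T}. V t \<in> frac_dom e lam \<sigma>) \<and>
     (\<exists>B. \<forall>t\<in>{0..T}. frac_norm e lam \<sigma> (V t) \<le> B) \<and>
     set_borel_measurable lborel {0..T} (\<lambda>s. F (V s)) \<and>
     (\<forall>t\<in>{0..T}. V t = exp (\<xi> t) *\<^sub>R semigroup_exp e lam t x +
        (LBINT s:{0..t}. semigroup_exp e lam (t - s) (exp (\<xi> t - \<xi> s) *\<^sub>R F (V s))))"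

lemma duhamel_solutionD:
  assumes "duhamel_solution \<sigma> F T \<xi> x V" "t \<in> {0..T}"
  shows "V t \<in> frac_dom e lam \<sigma>"
    and "V t = exp (\<xi> t) *\<^sub>R semigroup_exp e lam t x +
        (LBINT s:{0..t}. semigroup_exp e lam (t - s) (exp (\<xi> t - \<xi> s) *\<^sub>R F (V s)))"
    and "set_borel_measurable lborel {0..t} (\<lambda>s. F (V s))"
proof -
  have "set_borel_measurable lborel {0..T} (\<lambda>s. F (V s))"
    using assms(1) by (simp add: duhamel_solution_def)
  then show "set_borel_measurable lborel {0..t} (\<lambda>s. F (V s))"
    by (rule set_borel_measurable_subset) (use assms(2) in auto)
qed (use assms in \<open>auto simp: duhamel_solution_def\<close>)

lemma duhamel_solution_bounded:
  assumes "duhamel_solution \<sigma> F T \<xi> x V"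
  obtains B where "0 \<le> B" "\<And>t. t \<in> {0..T} \<Longrightarrow> frac_norm e lam \<sigma> (V t) \<le> B"
proof -
  obtain B where "\<forall>t\<in>{0..T}. frac_norm e lam \<sigma> (V t) \<le> B"
    using assms by (auto simp: duhamel_solution_def)
  then show thesis by (intro that[of "max 0 B"]) (auto intro: max.coboundedI2)
qed

lemma duhamel_multiplier_measurable:
  fixes g :: "real \<Rightarrow> 'h"
  assumes "set_borel_measurable lborel {0..t} g" "m \<in> borel_measurable borel"
  shows "set_borel_measurable lborel {0..t} (\<lambda>s. m s *\<^sub>R g s)"
proof -
  have "(\<lambda>s. m s *\<^sub>R (indicator {0..t} s *\<^sub>R g s)) \<in> borel_measurable lborel"
    using assms unfolding set_borel_measurable_def by measurable
  then show ?thesis by (simp add: set_borel_measurable_def mult_ac)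
qed

text \<open>The order of quantifiers is the point: \<open>c\<close> is fixed before the paths, the
  solutions and \<open>\<eta>\<close>. \<open>weighted_sup_closure\<close> is applied to each
  solution, for a bound in terms of \<open>x\<close> and \<open>K\<close> alone, and then to the
  difference.\<close>

theorem duhamel_stability:
  fixes F :: "'h \<Rightarrow> 'h" and L T K :: real
  assumes \<sigma>: "0 \<le> \<sigma>" "\<sigma> < 1" and L: "0 \<le> L" and F0: "F 0 = 0"
    and lip: "\<And>u1 u2. u1 \<in> frac_dom e lam \<sigma> \<Longrightarrow> u2 \<in> frac_dom e lam \<sigma> \<Longrightarrow>
            norm (F u1 - F u2) \<le> L * frac_norm e lam \<sigma> (u1 - u2)"
    and x: "x \<in> frac_dom e lam \<sigma>"
  obtains c where "0 \<le> c"
    and "\<And>\<xi>1 \<xi>2 \<eta> V1 V2 t. \<xi>1 \<in> borel_measurable borel \<Longrightarrow> \<xi>2 \<in> borel_measurable borel \<Longrightarrow>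
      duhamel_solution \<sigma> F T \<xi>1 x V1 \<Longrightarrow> duhamel_solution \<sigma> F T \<xi>2 x V2 \<Longrightarrow>
      \<forall>t\<in>{0..T}. \<bar>\<xi>1 t\<bar> \<le> K \<and> \<bar>\<xi>2 t\<bar> \<le> K \<and> \<bar>\<xi>1 t - \<xi>2 t\<bar> \<le> \<eta> \<Longrightarrow>
      t \<in> {0..T} \<Longrightarrow> frac_norm e lam \<sigma> (V1 t - V2 t) \<le> c * \<eta>"
proof -
  \<comment> \<open>Bounds every multiplier exp (\<xi> t - \<xi> s) when |\<xi>| \<le> K.\<close>
  define E where "E = exp (2 * K)"
  define X where "X = frac_norm e lam \<sigma> x"
  \<comment> \<open>Chosen so that E L \<kappa> \<le> 1/2, the factor that
    \<open>weighted_sup_closure\<close> asks for; the summand 1 keeps the denominator positive when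
    L = 0.\<close>
  define \<kappa> where "\<kappa> = 1 / (2 * (E * L + 1))"
  have E: "0 < E" by (simp add: E_def)
  have EL: "0 \<le> E * L" using E L by simp
  have \<kappa>: "0 < \<kappa>" using EL by (simp add: \<kappa>_def)
  have "E * L * \<kappa> = E * L / (2 * (E * L + 1))" by (simp add: \<kappa>_def)
  also have "\<dots> \<le> 1 / 2" using EL by (simp add: divide_simps)
  finally have EL\<kappa>: "E * L * \<kappa> \<le> 1 / 2" .
  have X: "0 \<le> X" by (simp add: X_def frac_norm_nonneg)
  obtain \<beta> where k_int: "\<And>t. t \<in> {0..T} \<Longrightarrow>
        set_integrable lborel {0..t} (\<lambda>s. (t - s) powr - \<sigma> * exp (\<beta> * s))"
    and k_le: "\<And>t. t \<in> {0..T} \<Longrightarrow>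
        (LBINT s:{0..t}. (t - s) powr - \<sigma> * exp (\<beta> * s)) \<le> \<kappa> * exp (\<beta> * t)"
    by (rule weighted_kernel_small[OF \<sigma> \<kappa>, of T]) (rule that)
  have \<sigma>1: "\<sigma> \<le> 1" using \<sigma> by simp
  note conv = semigroup_convolution[OF \<sigma>(1) \<sigma>1 _ _ _ _ k_int k_le]
  \<comment> \<open>The sign of \<open>\<beta>\<close> is unknown here, so e^(\<beta> t) may drop
    below 1 on [0,T]; the factor exp b compensates, and \<open>Y\<close> is the initial size
    measured in the weighted norm.\<close>
  define b where "b = max 0 (- \<beta> * T)"
  have weight: "1 \<le> exp b * exp (\<beta> * t)" if "t \<in> {0..T}" for t
  proof -
    have "- (\<beta> * t) \<le> b"
    proof (cases "\<beta> \<le> 0")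
      case True
      then have "- \<beta> * t \<le> - \<beta> * T" using that by (intro mult_left_mono) auto
      then show ?thesis by (simp add: b_def)
    next
      case False
      then have "0 \<le> \<beta> * t" using that by simp
      then show ?thesis by (simp add: b_def)
    qed
    then show ?thesis by (simp flip: exp_add)
  qed
  define Y where "Y = exp b * X"
  have Y: "0 \<le> Y" using X by (simp add: Y_def)
  have XY: "X \<le> Y * exp (\<beta> * t)" if "t \<in> {0..T}" for t
    using mult_right_mono[OF weight[OF that] X] by (simp add: Y_def mult_ac)
  have F_le: "norm (F u) \<le> L * frac_norm e lam \<sigma> u" if "u \<in> frac_dom e lam \<sigma>" for u
    using lip[OF that frac_dom_zero] F0 by simp
  have S_le: "frac_norm e lam \<sigma> (semigroup_exp e lam t x) \<le> X"
      "semigroup_exp e lam t x \<in> frac_dom e lam \<sigma>" if "t \<in> {0..T}" for t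
    using frac_norm_semigroup[of t x] that x by (auto simp: X_def)

  \<comment> \<open>The bound contained in \<open>duhamel_solution\<close> may depend on V and only
    starts the iteration; it is absent from the result.\<close>
  have apriori: "frac_norm e lam \<sigma> (V t) \<le> 2 * (E * Y) * exp (\<beta> * t)"
    if \<xi>m: "\<xi> \<in> borel_measurable borel" and V: "duhamel_solution \<sigma> F T \<xi> x V"
      and \<xi>: "\<And>t. t \<in> {0..T} \<Longrightarrow> \<bar>\<xi> t\<bar> \<le> K" and t: "t \<in> {0..T}" for \<xi> V t
  proof -
    obtain B where B: "0 \<le> B" "\<And>t. t \<in> {0..T} \<Longrightarrow> frac_norm e lam \<sigma> (V t) \<le> B"
      using duhamel_solution_bounded[OF V] by blast
    show ?thesis
    proof (rule weighted_sup_closure[OF _ B _ t])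
      show "0 \<le> E * Y" using E Y by simp
      fix M t assume M: "0 \<le> M" and V_le: "\<And>s. s \<in> {0..T} \<Longrightarrow> frac_norm e lam \<sigma> (V s) \<le> M * exp (\<beta> * s)"
        and t: "t \<in> {0..T}"
      let ?g = "\<lambda>s. exp (\<xi> t - \<xi> s) *\<^sub>R F (V s)"
      have t0: "0 \<le> t" using t by simp
      have g_meas: "set_borel_measurable lborel {0..t} ?g"
        by (rule duhamel_multiplier_measurable[OF duhamel_solutionD(3)[OF V t]]) (use \<xi>m in measurable)
      have g_le: "norm (?g s) \<le> (E * L * M) * exp (\<beta> * s)" if s: "s \<in> {0..t}" for s
      proof -
        have sT: "s \<in> {0..T}" using s t by auto
        have "exp (\<xi> t - \<xi> s) \<le> E"
          using \<xi>[OF t] \<xi>[OF sT] by (simp add: E_def)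
        moreover have "norm (F (V s)) \<le> L * (M * exp (\<beta> * s))"
          using F_le[OF duhamel_solutionD(1)[OF V sT]] mult_left_mono[OF V_le[OF sT] L] by linarith
        ultimately have "exp (\<xi> t - \<xi> s) * norm (F (V s)) \<le> E * (L * (M * exp (\<beta> * s)))"
          using E by (intro mult_mono) auto
        then show ?thesis by (simp add: mult_ac)
      qed
      have ELM: "0 \<le> E * L * M" using EL M by simp
      note c = conv[OF t0 ELM g_meas g_le t t]
      have "exp (\<xi> t) \<le> E" using \<xi>[OF t] by (simp add: E_def)
      then have first: "\<bar>exp (\<xi> t)\<bar> * frac_norm e lam \<sigma> (semigroup_exp e lam t x) \<le> E * (Y * exp (\<beta> * t))"
        using S_le(1)[OF t] XY[OF t] E by (intro mult_mono) (auto simp: frac_norm_nonneg)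
      have "E * L * \<kappa> * (M * exp (\<beta> * t)) \<le> 1 / 2 * (M * exp (\<beta> * t))"
        using EL\<kappa> M by (intro mult_right_mono) auto
      with c(3) first
        frac_norm_scaleR(2)[OF S_le(2)[OF t], of "exp (\<xi> t)"]
        frac_norm_add(2)[OF frac_norm_scaleR(1)[OF S_le(2)[OF t], of "exp (\<xi> t)"] c(2)]
      show "frac_norm e lam \<sigma> (V t) \<le> (E * Y + M / 2) * exp (\<beta> * t)"
        by (subst duhamel_solutionD(2)[OF V t]) (simp add: algebra_simps)
    qed
  qed

  show thesis
  \<comment> \<open>The initial term contributes E Y \<eta>. The changed multiplier contributes half
    of 2 \<eta> * 2 E Y, since E L \<kappa> \<le> 1/2. The closure lemma doubles the sum 3 E Y
    \<eta>.\<close>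
  proof (rule that[of "6 * E * Y * exp (\<bar>\<beta>\<bar> * T)"])
    show "0 \<le> 6 * E * Y * exp (\<bar>\<beta>\<bar> * T)" using E Y by simp
    fix \<xi>1 \<xi>2 V1 V2 t and \<eta> :: real
    assume \<xi>m: "\<xi>1 \<in> borel_measurable borel" "\<xi>2 \<in> borel_measurable borel"
      and V1: "duhamel_solution \<sigma> F T \<xi>1 x V1" and V2: "duhamel_solution \<sigma> F T \<xi>2 x V2"
      and \<xi>_close: "\<forall>t\<in>{0..T}. \<bar>\<xi>1 t\<bar> \<le> K \<and> \<bar>\<xi>2 t\<bar> \<le> K \<and> \<bar>\<xi>1 t - \<xi>2 t\<bar> \<le> \<eta>"
      and t: "t \<in> {0..T}"
    note \<xi> = bspec[OF \<xi>_close]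
    have \<eta>: "0 \<le> \<eta>" using \<xi>[OF t] by linarith
    have \<xi>E: "exp (\<xi>1 t - \<xi>1 s) \<le> E" "\<bar>exp (\<xi>1 t - \<xi>1 s) - exp (\<xi>2 t - \<xi>2 s)\<bar> \<le> E * (2 * \<eta>)"
      if "t \<in> {0..T}" "s \<in> {0..T}" for s t
    proof -
      note b = \<xi>[OF that(1)] \<xi>[OF that(2)]
      show "exp (\<xi>1 t - \<xi>1 s) \<le> E" using b unfolding E_def by (subst exp_le_cancel_iff) linarith
      have "\<bar>exp (\<xi>1 t - \<xi>1 s) - exp (\<xi>2 t - \<xi>2 s)\<bar>
          \<le> exp (2 * K) * \<bar>(\<xi>1 t - \<xi>1 s) - (\<xi>2 t - \<xi>2 s)\<bar>"
        using b by (intro abs_exp_diff_le) linarith+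
      also have "\<dots> \<le> exp (2 * K) * (2 * \<eta>)" using b by (intro mult_left_mono) (linarith, simp)
      finally show "\<bar>exp (\<xi>1 t - \<xi>1 s) - exp (\<xi>2 t - \<xi>2 s)\<bar> \<le> E * (2 * \<eta>)"
        by (simp add: E_def)
    qed
    obtain B1 where B1: "0 \<le> B1" "\<And>t. t \<in> {0..T} \<Longrightarrow> frac_norm e lam \<sigma> (V1 t) \<le> B1"
      using duhamel_solution_bounded[OF V1] by blast
    obtain B2 where B2: "0 \<le> B2" "\<And>t. t \<in> {0..T} \<Longrightarrow> frac_norm e lam \<sigma> (V2 t) \<le> B2"
      using duhamel_solution_bounded[OF V2] by blast
    have "frac_norm e lam \<sigma> (V1 t - V2 t) \<le> 2 * (3 * E * Y * \<eta>) * exp (\<beta> * t)"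
    proof (rule weighted_sup_closure[OF _ _ _ _ t])
      show "0 \<le> 3 * E * Y * \<eta>" using E Y \<eta> by simp
      show "0 \<le> B1 + B2" using B1 B2 by simp
      show "frac_norm e lam \<sigma> (V1 s - V2 s) \<le> B1 + B2" if "s \<in> {0..T}" for s
        using frac_norm_diff(2)[OF duhamel_solutionD(1)[OF V1 that] duhamel_solutionD(1)[OF V2 that]]
          B1(2)[OF that] B2(2)[OF that] by linarith
      fix M t assume M: "0 \<le> M"
        and D_le: "\<And>s. s \<in> {0..T} \<Longrightarrow> frac_norm e lam \<sigma> (V1 s - V2 s) \<le> M * exp (\<beta> * s)"
        and t: "t \<in> {0..T}"
      have t0: "0 \<le> t" using t by simp
      let ?g1 = "\<lambda>s. exp (\<xi>1 t - \<xi>1 s) *\<^sub>R F (V1 s)" and ?g2 = "\<lambda>s. exp (\<xi>2 t - \<xi>2 s) *\<^sub>R F (V2 s)"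
      let ?I = "\<lambda>g. LBINT s:{0..t}. semigroup_exp e lam (t - s) (g s)"
      have meas: "set_borel_measurable lborel {0..t} ?g1" "set_borel_measurable lborel {0..t} ?g2"
        by (rule duhamel_multiplier_measurable[OF duhamel_solutionD(3)[OF V1 t]], use \<xi>m in measurable)
           (rule duhamel_multiplier_measurable[OF duhamel_solutionD(3)[OF V2 t]], use \<xi>m in measurable)
      have int: "set_integrable lborel {0..t} (\<lambda>s. semigroup_exp e lam (t - s) (exp (\<xi> t - \<xi> s) *\<^sub>R F (V s)))"
        if V: "duhamel_solution \<sigma> F T \<xi> x V" and \<xi>: "\<And>t. t \<in> {0..T} \<Longrightarrow> \<bar>\<xi> t\<bar> \<le> K"
          and \<xi>m: "\<xi> \<in> borel_measurable borel" for \<xi> V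
      proof -
        have ge: "0 \<le> E * L * (2 * (E * Y))" using EL E Y by simp
        have mg: "set_borel_measurable lborel {0..t} (\<lambda>s. exp (\<xi> t - \<xi> s) *\<^sub>R F (V s))"
          by (rule duhamel_multiplier_measurable[OF duhamel_solutionD(3)[OF V t]]) (use \<xi>m in measurable)
        show ?thesis
        proof (rule conv(1)[OF t0 ge mg _ t t])
          fix s assume s: "s \<in> {0..t}"
          then have sT: "s \<in> {0..T}" using t by auto
          have "norm (F (V s)) \<le> L * (2 * (E * Y) * exp (\<beta> * s))"
            using F_le[OF duhamel_solutionD(1)[OF V sT]]
              mult_left_mono[OF apriori[OF \<xi>m V \<xi> sT] L] by linarith
          moreover have "exp (\<xi> t - \<xi> s) \<le> E" using \<xi>[OF t] \<xi>[OF sT] by (simp add: E_def)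
          ultimately have "exp (\<xi> t - \<xi> s) * norm (F (V s)) \<le> E * (L * (2 * (E * Y) * exp (\<beta> * s)))"
            using E by (intro mult_mono) auto
          then show "norm (exp (\<xi> t - \<xi> s) *\<^sub>R F (V s)) \<le> E * L * (2 * (E * Y)) * exp (\<beta> * s)"
            by (simp add: mult_ac)
        qed
      qed
      have int1: "set_integrable lborel {0..t} (\<lambda>s. semigroup_exp e lam (t - s) (?g1 s))"
        by (rule int[OF V1 _ \<xi>m(1)]) (use \<xi> in blast)
      have int2: "set_integrable lborel {0..t} (\<lambda>s. semigroup_exp e lam (t - s) (?g2 s))"
        by (rule int[OF V2 _ \<xi>m(2)]) (use \<xi> in blast)
      let ?d = "\<lambda>s. ?g1 s - ?g2 s"
      have "?I ?g1 - ?I ?g2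
          = (LBINT s:{0..t}. semigroup_exp e lam (t - s) (?g1 s) - semigroup_exp e lam (t - s) (?g2 s))"
        by (rule set_integral_diff(2)[OF int1 int2, symmetric])
      also have "\<dots> = ?I ?d"
        by (intro set_lebesgue_integral_cong) (auto simp: semigroup_diff)
      finally have I_diff: "?I ?g1 - ?I ?g2 = ?I ?d" .
      have d_meas: "set_borel_measurable lborel {0..t} ?d"
        using meas unfolding set_borel_measurable_def by (simp add: scaleR_diff_right)
      have ge: "0 \<le> E * L * (2 * \<eta> * (2 * (E * Y)) + M)" using EL E Y \<eta> M by simp
      have d_le: "norm (?d s) \<le> E * L * (2 * \<eta> * (2 * (E * Y)) + M) * exp (\<beta> * s)"
        if s: "s \<in> {0..t}" for s
      proof -
        have sT: "s \<in> {0..T}" using s t by auto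
        note dom = duhamel_solutionD(1)[OF V1 sT] duhamel_solutionD(1)[OF V2 sT]
        \<comment> \<open>The first summand carries the unknown difference and is absorbed by the
          contraction; the second is a source of order \<eta>, by the a priori bound on
          \<open>V2\<close>.\<close>
        have "?d s = exp (\<xi>1 t - \<xi>1 s) *\<^sub>R (F (V1 s) - F (V2 s))
            + (exp (\<xi>1 t - \<xi>1 s) - exp (\<xi>2 t - \<xi>2 s)) *\<^sub>R F (V2 s)"
          by (simp add: algebra_simps)
        then have "norm (?d s) \<le> exp (\<xi>1 t - \<xi>1 s) * norm (F (V1 s) - F (V2 s))
            + \<bar>exp (\<xi>1 t - \<xi>1 s) - exp (\<xi>2 t - \<xi>2 s)\<bar> * norm (F (V2 s))"
          by (simp only:) (rule order_trans[OF norm_triangle_ineq], simp)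
        moreover have "exp (\<xi>1 t - \<xi>1 s) * norm (F (V1 s) - F (V2 s)) \<le> E * (L * (M * exp (\<beta> * s)))"
          using \<xi>E(1)[OF t sT] order_trans[OF lip[OF dom] mult_left_mono[OF D_le[OF sT] L]] E
          by (intro mult_mono) auto
        moreover have "\<bar>exp (\<xi>1 t - \<xi>1 s) - exp (\<xi>2 t - \<xi>2 s)\<bar> * norm (F (V2 s))
            \<le> E * (2 * \<eta>) * (L * (2 * (E * Y) * exp (\<beta> * s)))"
        proof (rule mult_mono[OF \<xi>E(2)[OF t sT]])
          show "norm (F (V2 s)) \<le> L * (2 * (E * Y) * exp (\<beta> * s))"
            by (rule order_trans[OF F_le[OF dom(2)] mult_left_mono[OF apriori[OF \<xi>m(2) V2 _ sT] L]])
              (use \<xi> in blast)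
        qed (use E \<eta> in auto)
        ultimately have "norm (?d s) \<le> E * (L * (M * exp (\<beta> * s)))
            + E * (2 * \<eta>) * (L * (2 * (E * Y) * exp (\<beta> * s)))" by linarith
        also have "\<dots> = E * L * (2 * \<eta> * (2 * (E * Y)) + M) * exp (\<beta> * s)"
          by (simp add: algebra_simps)
        finally show ?thesis .
      qed
      note c = conv[OF t0 ge d_meas d_le t t]
      let ?f = "(exp (\<xi>1 t) - exp (\<xi>2 t)) *\<^sub>R semigroup_exp e lam t x"
      have V_diff: "V1 t - V2 t = ?f + ?I ?d"
        by (subst duhamel_solutionD(2)[OF V1 t], subst duhamel_solutionD(2)[OF V2 t])
          (simp add: I_diff[symmetric] algebra_simps)
      have "\<bar>exp (\<xi>1 t) - exp (\<xi>2 t)\<bar> \<le> E * \<bar>\<xi>1 t - \<xi>2 t\<bar>"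
        unfolding E_def using \<xi>[OF t] by (intro abs_exp_diff_le) linarith+
      also have "\<dots> \<le> E * \<eta>" using \<xi>[OF t] E by (intro mult_left_mono) auto
      finally have "\<bar>exp (\<xi>1 t) - exp (\<xi>2 t)\<bar> * frac_norm e lam \<sigma> (semigroup_exp e lam t x)
          \<le> E * \<eta> * (Y * exp (\<beta> * t))"
        using S_le(1)[OF t] XY[OF t] E \<eta> by (intro mult_mono) (auto simp: frac_norm_nonneg)
      moreover have "E * L * \<kappa> * ((2 * \<eta> * (2 * (E * Y)) + M) * exp (\<beta> * t))
          \<le> 1 / 2 * ((2 * \<eta> * (2 * (E * Y)) + M) * exp (\<beta> * t))"
        using EL\<kappa> M \<eta> E Y by (intro mult_right_mono) auto
      ultimately show "frac_norm e lam \<sigma> (V1 t - V2 t) \<le> (3 * E * Y * \<eta> + M / 2) * exp (\<beta> * t)"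
        unfolding V_diff
        using c(3) frac_norm_scaleR(2)[OF S_le(2)[OF t], of "exp (\<xi>1 t) - exp (\<xi>2 t)"]
          frac_norm_add(2)[OF frac_norm_scaleR(1)[OF S_le(2)[OF t], of "exp (\<xi>1 t) - exp (\<xi>2 t)"] c(2)]
        by (simp add: algebra_simps)
    qed
    also have "\<dots> \<le> 2 * (3 * E * Y * \<eta>) * exp (\<bar>\<beta>\<bar> * T)"
    proof (rule mult_left_mono)
      have "\<beta> * t \<le> \<bar>\<beta>\<bar> * T" using t by (intro mult_mono) auto
      then show "exp (\<beta> * t) \<le> exp (\<bar>\<beta>\<bar> * T)" by simp
    qed (use E Y \<eta> in simp)
    finally show "frac_norm e lam \<sigma> (V1 t - V2 t) \<le> 6 * E * Y * exp (\<bar>\<beta>\<bar> * T) * \<eta>"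
      by (simp add: mult_ac)
  qed
qed

end

section \<open>The stationary Ornstein--Uhlenbeck process of a path\<close>

text \<open>The properties shared by \<open>\<omega>\<close> and
  \<open>\<omega> \<circ> ell\<close>: right-continuous with left limits, jumps being allowed.
  Growth is controlled only at -\<infinity>, since z integrates over the past, and \<xi> 0 = 0 turns
  the increment from time 0 into \<xi> t.\<close>

definition driving_path :: "(real \<Rightarrow> real) \<Rightarrow> bool" where
  "driving_path \<xi> \<longleftrightarrow> \<xi> 0 = 0 \<and> \<xi> \<in> borel_measurable borel \<and>
     (\<forall>a b. \<exists>B. \<forall>t\<in>{a..b}. \<bar>\<xi> t\<bar> \<le> B) \<and> ((\<lambda>t. \<xi> t / t) \<longlongrightarrow> 0) at_bot \<and>
     (\<forall>t. (\<xi> \<longlongrightarrow> \<xi> t) (at_right t)) \<and> (\<forall>t. \<exists>l. (\<xi> \<longlongrightarrow> l) (at_left t))"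

text \<open>The limit at 0 in \<open>subordinator_paths\<close> ignores the value there; right
  continuity identifies it.\<close>

lemma subordinator_at_0:
  assumes "ell \<in> subordinator_paths"
  shows "ell 0 = 0"
proof (rule tendsto_unique)
  show "(ell \<longlongrightarrow> ell 0) (at_right 0)"
    using assms by (auto simp: subordinator_paths_def continuous_within)
  show "(ell \<longlongrightarrow> 0) (at_right 0)"
    using assms by (auto simp: subordinator_paths_def intro: filterlim_mono at_le)
qed simp

text \<open>Makes the Stratonovich path the special case \<open>\<omega> \<circ> id\<close> of a
  time-changed path.\<close>

lemma id_subordinator: "id \<in> subordinator_paths"
  by (auto simp: subordinator_paths_def mono_def continuous_within id_def intro: tendsto_ident_at)

text \<open>The continuous \<open>\<omega>\<close> transports the one-sided limits of the monotone
  \<open>ell\<close>, and on [a,b] it is evaluated only in the compact interval from ell a to ell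
  b.\<close>

lemma driving_path_comp:
  assumes \<omega>: "\<omega> \<in> wiener_paths" and ell: "ell \<in> subordinator_paths"
    and lim: "((\<lambda>t. \<omega> (ell t) / t) \<longlongrightarrow> 0) at_bot"
  shows "driving_path (\<omega> \<circ> ell)"
proof -
  have cont: "continuous_on UNIV \<omega>" and \<omega>0: "\<omega> 0 = 0" using \<omega> by (auto simp: wiener_paths_def)
  have tend: "((\<lambda>x. \<omega> (f x)) \<longlongrightarrow> \<omega> l) G" if "(f \<longlongrightarrow> l) G" for f l and G :: "real filter"
    using cont that by (intro isCont_tendsto_compose[of l \<omega>]) (auto simp: continuous_on_eq_continuous_at)
  have mono: "mono ell" and right: "(ell \<longlongrightarrow> ell t) (at_right t)" for t
    using ell by (auto simp: subordinator_paths_def continuous_within)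
  have left: "(ell \<longlongrightarrow> Sup (ell ` {..<t})) (at_left t)" for t
  proof -
    have "(ell \<longlongrightarrow> Sup (ell ` ({..<t} \<inter> UNIV))) (at t within ({..<t} \<inter> UNIV))"
      by (rule Lim_left_bound[where K = "ell t"]) (auto intro: monoD[OF mono])
    then show ?thesis by simp
  qed
  have bounded: "\<exists>B. \<forall>t\<in>{a..b}. \<bar>\<omega> (ell t)\<bar> \<le> B" for a b
  proof -
    have cp: "compact (\<omega> ` {ell a..ell b})"
      using cont by (intro compact_continuous_image continuous_on_subset[OF cont]) auto
    obtain B where "\<forall>y\<in>\<omega> ` {ell a..ell b}. \<bar>y\<bar> \<le> B"
      using bounded_real[THEN iffD1, OF compact_imp_bounded[OF cp]] by auto
    then show ?thesis by (intro exI[of _ B]) (auto intro!: monoD[OF mono])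
  qed
  have "ell \<in> borel_measurable borel" using mono by (rule borel_measurable_mono)
  moreover have "\<omega> \<in> borel_measurable borel" using cont by (rule borel_measurable_continuous_onI)
  ultimately have "\<omega> \<circ> ell \<in> borel_measurable borel" by (rule measurable_comp)
  then show ?thesis
    unfolding driving_path_def o_def
    using \<omega>0 subordinator_at_0[OF ell] bounded lim tend[OF right] tend[OF left]
    by (intro conjI) (simp_all add: o_def, blast)
qed

lemma bounded_set_integrable:
  fixes f :: "real \<Rightarrow> 'b::{banach, second_countable_topology}"
  assumes "A \<in> sets lborel" "A \<subseteq> {a..b}" "f \<in> borel_measurable borel" "\<And>r. r \<in> A \<Longrightarrow> norm (f r) \<le> B"
  shows "set_integrable lborel A f"
  unfolding set_integrable_def
proof (rule integrableI_bounded_set_indicator)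
  have "emeasure lborel A \<le> emeasure lborel {a..b}" using assms by (intro emeasure_mono) auto
  also have "\<dots> < \<infinity>" by (simp add: emeasure_lborel_Icc_eq)
  finally show "emeasure lborel A < \<infinity>" .
qed (use assms in auto)

lemma exp_primitive:
  assumes "p \<le> (t::real)"
  shows "(LBINT r:{p..t}. exp (- r)) = exp (- p) - exp (- t)"
proof -
  have "((\<lambda>r. exp (- r)) has_integral (- exp (- t) - - exp (- p))) {p..t}"
    by (rule fundamental_theorem_of_calculus[OF assms])
      (auto intro!: derivative_eq_intros simp flip: has_real_derivative_iff_has_vector_derivative)
  moreover have "set_integrable lborel {p..t} (\<lambda>r. exp (- r))"
    by (intro borel_integrable_atLeastAtMost' continuous_intros)
  ultimately show ?thesis
    using set_borel_integral_eq_integral(2)[of "{p..t}" "\<lambda>r. exp (- r)"] by (simp add: integral_unique)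
qed

section \<open>Regularity of the stationary process and its integrated equation\<close>

locale driving =
  fixes \<xi> :: "real \<Rightarrow> real"
  assumes driving: "driving_path \<xi>"
begin

lemma measurable_path [measurable]: "\<xi> \<in> borel_measurable borel"
  using driving by (simp add: driving_path_def)

lemma bounded_path: obtains B where "0 \<le> B" "\<And>t. t \<in> {a..b} \<Longrightarrow> \<bar>\<xi> t\<bar> \<le> B"
proof -
  obtain B where "\<forall>t\<in>{a..b}. \<bar>\<xi> t\<bar> \<le> B"
    using driving unfolding driving_path_def by blast
  then show thesis by (intro that[of "max 0 B"]) (auto intro: max.coboundedI2)
qed

text \<open>After the substitution r = t + s, the past average in z at time t is e^(-t) times this
  quantity. The integrand no longer depends on t, so increments are integrals over (s,t].\<close>

definition weighted_integral :: "real \<Rightarrow> real" where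
  "weighted_integral t = (LBINT r:{..t}. exp r * \<xi> r)"

text \<open>Sublinear growth gives |\<xi> r| \<le> -r \<le> 2 e^(-r/2) far to the left, so the
  integrand is at most 2 e^(r/2); the rest is a bounded function on a bounded interval.\<close>

lemma weighted_path_integrable: "set_integrable lborel {..t} (\<lambda>r. exp r * \<xi> r)"
proof -
  have "eventually (\<lambda>r. \<bar>\<xi> r / r\<bar> < 1) at_bot"
    using driving order_tendstoD(2)[OF tendsto_rabs_zero, of "\<lambda>t. \<xi> t / t" at_bot 1]
    by (simp add: driving_path_def)
  then obtain N0 where N0: "\<And>r. r \<le> N0 \<Longrightarrow> \<bar>\<xi> r / r\<bar> < 1" by (auto simp: eventually_at_bot_linorder)
  \<comment> \<open>The cap at -1 makes r negative, so that |\<xi> r / r| < 1 reads |\<xi> r| \<le>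
    -r.\<close>
  define N where "N = min N0 (- 1)"
  have N: "\<bar>\<xi> r\<bar> \<le> - r" if "r \<le> N" for r
    using N0[of r] that by (auto simp: N_def divide_simps abs_if split: if_splits)
  have exp_int: "set_integrable lborel {..N} (\<lambda>r. exp (r / 2))"
  proof -
    have "set_integrable lborel {- N..} (\<lambda>r. exp (- (1 / 2) * r))"
      by (intro set_integrable_lborel_nonneg integrable_on_exp_minus_to_infinity) auto
    then have "integrable lborel (\<lambda>r. indicator {- N..} r *\<^sub>R exp (- (1 / 2) * r))"
      unfolding set_integrable_def .
    from lborel_integrable_real_affine[OF this, of "-1" 0]
    have "integrable lborel (\<lambda>r. indicator {- N..} (- r) *\<^sub>R exp (r / 2))" by simp
    moreover have "indicat_real {- N..} (- r) = indicator {..N} r" for r :: real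
      by (auto simp: indicator_def)
    ultimately show ?thesis by (simp add: set_integrable_def)
  qed
  have "set_integrable lborel {..N} (\<lambda>r. exp r * \<xi> r)"
  proof (rule set_integrable_bound[OF set_integrable_mult_right[OF exp_int, of 2]])
    have "norm (exp r * \<xi> r) \<le> norm (2 * exp (r / 2))" if "r \<in> {..N}" for r
    proof -
      have "- r / 2 \<le> exp (- r / 2)" using exp_ge_add_one_self[of "- r / 2"] by linarith
      then have "\<bar>\<xi> r\<bar> \<le> 2 * exp (- r / 2)" using N[of r] that by auto
      then have "exp r * \<bar>\<xi> r\<bar> \<le> exp r * (2 * exp (- r / 2))" by (intro mult_left_mono) auto
      also have "\<dots> = 2 * (exp r * exp (- r / 2))" by simp
      also have "exp r * exp (- r / 2) = exp (r / 2)" by (subst exp_add[symmetric]) simp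
      finally show ?thesis by (simp add: abs_mult)
    qed
    then show "AE r in lborel. r \<in> {..N} \<longrightarrow> norm (exp r * \<xi> r) \<le> norm (2 * exp (r / 2))" by auto
  qed (auto simp: set_borel_measurable_def)
  moreover have "set_integrable lborel {N..t} (\<lambda>r. exp r * \<xi> r)"
  proof -
    obtain B where B: "0 \<le> B" "\<And>r. r \<in> {N..t} \<Longrightarrow> \<bar>\<xi> r\<bar> \<le> B" using bounded_path by blast
    show ?thesis
    proof (rule bounded_set_integrable)
      show "norm (exp r * \<xi> r) \<le> exp t * B" if "r \<in> {N..t}" for r
        using B that by (simp add: abs_mult mult_mono)
    qed auto
  qed
  ultimately have "set_integrable lborel ({..N} \<union> {N..t}) (\<lambda>r. exp r * \<xi> r)"
    by (rule set_integrable_Un) auto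
  then show ?thesis by (rule set_integrable_subset) auto
qed

lemma weighted_integral_diff:
  assumes "s \<le> t"
  shows "weighted_integral t = weighted_integral s + (LBINT r:{s<..t}. exp r * \<xi> r)"
proof -
  have "{..t} = {..s} \<union> {s<..t}" "{..s} \<inter> {s<..t} = {}" using assms by auto
  moreover have "set_integrable lborel {s<..t} (\<lambda>r. exp r * \<xi> r)"
    by (rule set_integrable_subset[OF weighted_path_integrable[of t]]) auto
  ultimately show ?thesis
    unfolding weighted_integral_def using set_integral_Un[OF _ weighted_path_integrable[of s], of "{s<..t}"] by simp
qed

text \<open>An integral of a locally bounded function. Hence \<open>weighted_integral\<close> is
  continuous across the jumps of \<xi>, and z jumps exactly as \<xi> does.\<close>

lemma weighted_integral_lipschitz:
  obtains B where "0 \<le> B" "\<And>s t. a \<le> s \<Longrightarrow> s \<le> t \<Longrightarrow> t \<le> b \<Longrightarrow> \<bar>weighted_integral t - weighted_integral s\<bar> \<le> B * (t - s)"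
proof -
  obtain B where B: "0 \<le> B" "\<And>r. r \<in> {a..b} \<Longrightarrow> \<bar>\<xi> r\<bar> \<le> B" using bounded_path by blast
  show thesis
  proof (rule that[of "exp b * B"])
    fix s t assume st: "a \<le> s" "s \<le> t" "t \<le> b"
    have "norm (LBINT r:{s<..t}. exp r * \<xi> r) \<le> (LBINT r:{s<..t}. norm (exp r * \<xi> r))"
      by (rule set_integral_norm_bound) (rule set_integrable_subset[OF weighted_path_integrable[of t]], auto)
    also have "\<dots> \<le> (LBINT r:{s<..t}. exp b * B)"
    proof (rule set_integral_mono)
      show "set_integrable lborel {s<..t} (\<lambda>r. norm (exp r * \<xi> r))"
        by (intro set_integrable_norm set_integrable_subset[OF weighted_path_integrable[of t]]) auto
      show "set_integrable lborel {s<..t} (\<lambda>r. exp b * B)"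
        by (rule bounded_set_integrable[where a=s and b=t]) auto
      show "norm (exp r * \<xi> r) \<le> exp b * B" if "r \<in> {s<..t}" for r
        using B st that by (simp add: abs_mult mult_mono)
    qed
    also have "\<dots> = exp b * B * (t - s)" using st by (simp add: set_lebesgue_integral_def)
    finally show "\<bar>weighted_integral t - weighted_integral s\<bar> \<le> exp b * B * (t - s)" using weighted_integral_diff[OF st(2)] by simp
  qed (use B in simp)
qed

lemma weighted_integral_continuous: "isCont weighted_integral t"
proof -
  obtain B where B: "0 \<le> B" "\<And>s u. t - 1 \<le> s \<Longrightarrow> s \<le> u \<Longrightarrow> u \<le> t + 1 \<Longrightarrow> \<bar>weighted_integral u - weighted_integral s\<bar> \<le> B * (u - s)"
    using weighted_integral_lipschitz[of "t - 1" "t + 1"] by blast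
  have "\<bar>weighted_integral r - weighted_integral t\<bar> \<le> B * \<bar>r - t\<bar>" if "\<bar>r - t\<bar> < 1" for r
    using B(2)[of r t] B(2)[of t r] that by (cases "r \<le> t") (auto simp: abs_minus_commute)
  then have "eventually (\<lambda>r. norm (weighted_integral r - weighted_integral t) \<le> B * \<bar>r - t\<bar>) (at t)"
    unfolding eventually_at by (intro exI[of _ 1]) (auto simp: dist_real_def)
  moreover have "((\<lambda>r. B * \<bar>r - t\<bar>) \<longlongrightarrow> 0) (at t)"
    by (auto intro!: tendsto_eq_intros)
  ultimately have "((\<lambda>r. weighted_integral r - weighted_integral t) \<longlongrightarrow> 0) (at t)" by (rule Lim_null_comparison)
  then show ?thesis by (simp add: isCont_def LIM_zero_iff)
qed

lemma ou_process_eq: "ou_process \<xi> t = \<xi> t - exp (- t) * weighted_integral t"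
proof -
  have "weighted_integral t = (LINT s|lborel. indicator {..t} (t + s) *\<^sub>R (exp (t + s) * \<xi> (t + s)))"
    using lborel_integral_real_affine[of 1 "\<lambda>r. indicator {..t} r *\<^sub>R (exp r * \<xi> r)" t]
    by (simp add: weighted_integral_def set_lebesgue_integral_def)
  also have "\<dots> = (LBINT s:{..0}. exp t * (exp s * \<xi> (t + s)))"
    unfolding set_lebesgue_integral_def
    by (intro Bochner_Integration.integral_cong) (auto simp: indicator_def exp_add)
  finally have "exp (- t) * weighted_integral t = (LBINT s:{..0}. exp s * \<xi> (t + s))"
    by (simp add: exp_minus)
  then show ?thesis by (simp add: ou_process_def)
qed

lemma measurable_ou [measurable]: "ou_process \<xi> \<in> borel_measurable borel"
proof -
  have "weighted_integral \<in> borel_measurable borel"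
    by (intro borel_measurable_continuous_onI continuous_at_imp_continuous_on) (simp add: weighted_integral_continuous)
  moreover have "ou_process \<xi> = (\<lambda>t. \<xi> t - exp (- t) * weighted_integral t)"
    by (rule ext) (rule ou_process_eq)
  ultimately show ?thesis by simp
qed

lemma bounded_ou: obtains B where "0 \<le> B" "\<And>t. t \<in> {a..b} \<Longrightarrow> \<bar>ou_process \<xi> t\<bar> \<le> B"
proof -
  obtain B where B: "0 \<le> B" "\<And>t. t \<in> {a..b} \<Longrightarrow> \<bar>\<xi> t\<bar> \<le> B" using bounded_path by blast
  have cp: "compact ((\<lambda>t. exp (- t) * weighted_integral t) ` {a..b})"
    by (intro compact_continuous_image continuous_at_imp_continuous_on ballI continuous_intros weighted_integral_continuous) auto
  obtain C where C: "\<forall>y\<in>(\<lambda>t. exp (- t) * weighted_integral t) ` {a..b}. \<bar>y\<bar> \<le> C"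
    using bounded_real[THEN iffD1, OF compact_imp_bounded[OF cp]] by auto
  show thesis
  proof (rule that[of "B + \<bar>C\<bar>"])
    show "\<bar>ou_process \<xi> t\<bar> \<le> B + \<bar>C\<bar>" if "t \<in> {a..b}" for t
    proof -
      have "\<bar>exp (- t) * weighted_integral t\<bar> \<le> C" using C that by blast
      then show ?thesis using B(2)[OF that] unfolding ou_process_eq by linarith
    qed
  qed (use B in simp)
qed

lemma ou_right_continuous: "(ou_process \<xi> \<longlongrightarrow> ou_process \<xi> t) (at_right t)"
  unfolding ou_process_eq[abs_def]
proof (intro tendsto_diff tendsto_mult)
  show "(\<xi> \<longlongrightarrow> \<xi> t) (at_right t)" using driving by (simp add: driving_path_def)
  show "(weighted_integral \<longlongrightarrow> weighted_integral t) (at_right t)"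
    by (rule filterlim_mono[OF weighted_integral_continuous[unfolded isCont_def] order_refl at_le]) simp
qed (intro tendsto_intros)

lemma ou_left_limit: "\<exists>l. (ou_process \<xi> \<longlongrightarrow> l) (at_left t)"
proof -
  obtain l where l: "(\<xi> \<longlongrightarrow> l) (at_left t)"
    using driving unfolding driving_path_def by blast
  have "(weighted_integral \<longlongrightarrow> weighted_integral t) (at_left t)"
    by (rule filterlim_mono[OF weighted_integral_continuous[unfolded isCont_def] order_refl at_le]) simp
  then have "(ou_process \<xi> \<longlongrightarrow> l - exp (- t) * weighted_integral t) (at_left t)"
    unfolding ou_process_eq[abs_def] by (intro tendsto_intros l)
  then show ?thesis by blast
qed

text \<open>The integrated form of \<open>dz = - z dt + d\<xi>\<close>; \<open>\<xi>\<close> may jump, hence Fubini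
  instead of the fundamental theorem of calculus.\<close>
lemma ou_process_increment:
  assumes st: "s \<le> t"
  shows "ou_process \<xi> t - ou_process \<xi> s + (LBINT r:{s..t}. ou_process \<xi> r) = \<xi> t - \<xi> s"
proof -
  define f where "f r = exp r * \<xi> r" for r
  have f_meas [measurable]: "f \<in> borel_measurable borel" unfolding f_def by measurable
  obtain B where B: "0 \<le> B" "\<And>r. r \<in> {s..t} \<Longrightarrow> \<bar>\<xi> r\<bar> \<le> B" using bounded_path by blast
  have f_le: "\<bar>f r\<bar> \<le> exp t * B" if "r \<in> {s..t}" for r
    using B that by (simp add: f_def abs_mult mult_mono)
  have f_int: "set_integrable lborel A f" if "A \<subseteq> {s..t}" "A \<in> sets lborel" for A
    using that f_le by (intro bounded_set_integrable[of A s t f "exp t * B"]) auto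
  \<comment> \<open>The function e^(-r) f(p) on the triangle s < p \<le> r \<le> t. Integrating over
    p gives e^(-r) times the increment of \<open>weighted_integral\<close> from s to r; integrating
    over r gives \<xi> p - e^(-t) f(p).\<close>
  define h where "h r p = (if p \<le> r then exp (- r) * f p else 0)" for r p :: real
  have "integrable (lborel \<Otimes>\<^sub>M lborel)
      (\<lambda>x. indicator ({s..t} \<times> {s<..t}) x *\<^sub>R h (fst x) (snd x))"
  proof (rule integrableI_bounded_set_indicator)
    show "(\<lambda>x. h (fst x) (snd x)) \<in> borel_measurable (lborel \<Otimes>\<^sub>M lborel)"
      unfolding h_def by measurable
    show "emeasure (lborel \<Otimes>\<^sub>M lborel) ({s..t} \<times> {s<..t}) < \<infinity>"
      by (subst lborel.emeasure_pair_measure_Times)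
         (auto simp: emeasure_lborel_Icc_eq emeasure_lborel_Ioc st ennreal_mult_less_top)
    have "norm (h r p) \<le> exp (- s) * (exp t * B)" if "r \<in> {s..t}" "p \<in> {s<..t}" for r p
      using f_le[of p] that B by (auto simp: h_def abs_mult intro!: mult_mono)
    then show "AE x in lborel \<Otimes>\<^sub>M lborel. x \<in> {s..t} \<times> {s<..t} \<longrightarrow>
        norm (h (fst x) (snd x)) \<le> exp (- s) * (exp t * B)"
      by (intro AE_I2) auto
  qed simp
  then have int: "integrable (lborel \<Otimes>\<^sub>M lborel)
      (case_prod (\<lambda>r p. indicator {s..t} r * (indicator {s<..t} p * h r p)))"
    by (simp add: case_prod_unfold indicator_times mult.assoc)
  have fubini: "(LINT r|lborel. LINT p|lborel. indicator {s..t} r * (indicator {s<..t} p * h r p))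
      = (LINT p|lborel. LINT r|lborel. indicator {s..t} r * (indicator {s<..t} p * h r p))"
    using lborel_pair.Fubini_integral[OF int] by simp
  have inner1: "(LINT p|lborel. indicator {s..t} r * (indicator {s<..t} p * h r p))
      = indicator {s..t} r * (exp (- r) * (weighted_integral r - weighted_integral s))" for r
  proof (cases "r \<in> {s..t}")
    case True
    have "(LINT p|lborel. indicator {s<..t} p * h r p) = (LINT p|lborel. exp (- r) * (indicator {s<..r} p *\<^sub>R f p))"
      using True by (intro Bochner_Integration.integral_cong) (auto simp: h_def indicator_def)
    also have "\<dots> = exp (- r) * (weighted_integral r - weighted_integral s)"
      using weighted_integral_diff[of s r] True by (simp add: set_lebesgue_integral_def f_def)
    finally show ?thesis by simp
  qed simp
  have inner2: "(LINT r|lborel. indicator {s..t} r * (indicator {s<..t} p * h r p))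
      = indicator {s<..t} p * (\<xi> p - exp (- t) * f p)" for p
  proof (cases "p \<in> {s<..t}")
    case True
    have "(LINT r|lborel. indicator {s..t} r * (indicator {s<..t} p * h r p))
        = (LINT r|lborel. (indicator {p..t} r *\<^sub>R exp (- r)) * f p)"
      using True by (intro Bochner_Integration.integral_cong) (auto simp: h_def indicator_def)
    also have "\<dots> = (exp (- p) - exp (- t)) * f p"
      using exp_primitive[of p t] True by (simp add: set_lebesgue_integral_def)
    also have "\<dots> = \<xi> p - exp (- t) * f p"
      by (simp add: f_def algebra_simps exp_minus)
    finally show ?thesis using True by simp
  qed simp
  have "(LBINT r:{s..t}. exp (- r) * (weighted_integral r - weighted_integral s))
      = (LBINT p:{s<..t}. \<xi> p - exp (- t) * f p)"
    using fubini unfolding inner1 inner2 by (simp add: set_lebesgue_integral_def)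
  also have "\<dots> = (LBINT p:{s<..t}. \<xi> p) - (LBINT p:{s<..t}. exp (- t) * f p)"
  proof (rule set_integral_diff(2))
    show "set_integrable lborel {s<..t} \<xi>"
      using B by (intro bounded_set_integrable[of "{s<..t}" s t \<xi> B]) auto
  qed (intro set_integrable_mult_right f_int, auto)
  also have "(LBINT p:{s<..t}. \<xi> p) = (LBINT p:{s..t}. \<xi> p)"
    unfolding set_lebesgue_integral_def
    by (intro integral_cong_AE eventually_mono[OF AE_lborel_singleton[of s]])
       (auto simp: indicator_def)
  also have "(LBINT p:{s<..t}. exp (- t) * f p) = exp (- t) * (weighted_integral t - weighted_integral s)"
    using weighted_integral_diff[OF st] by (simp add: f_def)
  finally have A: "(LBINT r:{s..t}. exp (- r) * (weighted_integral r - weighted_integral s))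
      = (LBINT p:{s..t}. \<xi> p) - exp (- t) * (weighted_integral t - weighted_integral s)" .
  have i1: "set_integrable lborel {s..t} (\<lambda>r. exp (- r) * (weighted_integral r - weighted_integral s))"
    by (intro borel_integrable_atLeastAtMost' continuous_at_imp_continuous_on ballI
        continuous_intros weighted_integral_continuous) 
  have i2: "set_integrable lborel {s..t} (\<lambda>r. exp (- r) * weighted_integral s)"
    by (intro borel_integrable_atLeastAtMost' continuous_intros)
  have i3: "set_integrable lborel {s..t} \<xi>"
    using B by (intro bounded_set_integrable[of "{s..t}" s t \<xi> B]) auto
  \<comment> \<open>Splitting \<open>weighted_integral r\<close> at s isolates the double integral
    evaluated in \<open>A\<close>; what remains is a constant times an explicit exponential
    integral.\<close>
  have "(LBINT r:{s..t}. ou_process \<xi> r)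
      = (LBINT r:{s..t}. \<xi> r - (exp (- r) * (weighted_integral r - weighted_integral s) + exp (- r) * weighted_integral s))"
    by (simp add: ou_process_eq algebra_simps)
  also have "\<dots> = (LBINT r:{s..t}. \<xi> r) -
      ((LBINT r:{s..t}. exp (- r) * (weighted_integral r - weighted_integral s)) + (LBINT r:{s..t}. exp (- r) * weighted_integral s))"
    by (simp only: set_integral_diff(2)[OF i3 set_integral_add(1)[OF i1 i2]] set_integral_add(2)[OF i1 i2])
  also have "(LBINT r:{s..t}. exp (- r) * weighted_integral s) = (exp (- s) - exp (- t)) * weighted_integral s"
    using exp_primitive[OF st] by simp
  finally show ?thesis unfolding A ou_process_eq by (simp add: algebra_simps)
qed

end

section \<open>From the conjugated equation to the equation for the original unknown\<close>

context discrete_spectrum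
begin

text \<open>Uses c w - c0 w0 = c (w - w0) + (c - c0) w0. The filter is arbitrary because the rule
  serves right limits, left limits and limits in the plane; at a jump, \<open>c0\<close> is the
  one-sided limit of the scalar.\<close>

lemma frac_norm_scaled_tendsto:
  assumes c: "(c \<longlongrightarrow> c0) G" and w: "((\<lambda>p. frac_norm e lam \<sigma> (w p - w0)) \<longlongrightarrow> 0) G"
    and dom: "eventually (\<lambda>p. w p \<in> frac_dom e lam \<sigma>) G" "w0 \<in> frac_dom e lam \<sigma>"
  shows "((\<lambda>p. frac_norm e lam \<sigma> (c p *\<^sub>R w p - c0 *\<^sub>R w0)) \<longlongrightarrow> 0) G"
proof (rule Lim_null_comparison)
  have "frac_norm e lam \<sigma> (c p *\<^sub>R w p - c0 *\<^sub>R w0)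
      \<le> \<bar>c p\<bar> * frac_norm e lam \<sigma> (w p - w0) + \<bar>c p - c0\<bar> * frac_norm e lam \<sigma> w0"
    if "w p \<in> frac_dom e lam \<sigma>" for p
  proof -
    have eq: "c p *\<^sub>R w p - c0 *\<^sub>R w0 = c p *\<^sub>R (w p - w0) + (c p - c0) *\<^sub>R w0"
      by (simp add: algebra_simps)
    note d = frac_norm_diff(1)[OF that dom(2)]
    show ?thesis
      unfolding eq
      using frac_norm_add(2)[OF frac_norm_scaleR(1)[OF d, of "c p"] frac_norm_scaleR(1)[OF dom(2), of "c p - c0"]]
        frac_norm_scaleR(2)[OF d, of "c p"] frac_norm_scaleR(2)[OF dom(2), of "c p - c0"]
      by linarith
  qed
  then show "eventually (\<lambda>p. norm (frac_norm e lam \<sigma> (c p *\<^sub>R w p - c0 *\<^sub>R w0))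
      \<le> \<bar>c p\<bar> * frac_norm e lam \<sigma> (w p - w0) + \<bar>c p - c0\<bar> * frac_norm e lam \<sigma> w0) G"
    by (intro eventually_mono[OF dom(1)]) (simp add: frac_norm_nonneg)
  have "((\<lambda>p. \<bar>c p\<bar> * frac_norm e lam \<sigma> (w p - w0) + \<bar>c p - c0\<bar> * frac_norm e lam \<sigma> w0)
      \<longlongrightarrow> \<bar>c0\<bar> * 0 + \<bar>c0 - c0\<bar> * frac_norm e lam \<sigma> w0) G"
    by (intro tendsto_intros c w)
  then show "((\<lambda>p. \<bar>c p\<bar> * frac_norm e lam \<sigma> (w p - w0) + \<bar>c p - c0\<bar> * frac_norm e lam \<sigma> w0)
      \<longlongrightarrow> 0) G" by simp
qed

lemma frac_continuous_bounded:
  fixes u :: "real \<Rightarrow> 'h"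
  assumes dom: "\<And>t. 0 \<le> t \<Longrightarrow> u t \<in> frac_dom e lam \<sigma>"
    and cont: "\<And>t. 0 \<le> t \<Longrightarrow> ((\<lambda>s. frac_norm e lam \<sigma> (u s - u t)) \<longlongrightarrow> 0) (at t within {0..})"
  obtains B where "0 \<le> B" "\<And>t. t \<in> {0..T} \<Longrightarrow> frac_norm e lam \<sigma> (u t) \<le> B"
proof -
  have "continuous_on {0..T} (\<lambda>t. frac_norm e lam \<sigma> (u t))"
    unfolding continuous_on_def
  proof
    fix t assume t: "t \<in> {0..T}"
    have diff: "\<bar>frac_norm e lam \<sigma> (u s) - frac_norm e lam \<sigma> (u t)\<bar> \<le> frac_norm e lam \<sigma> (u s - u t)"
      if s: "s \<in> {0..T}" for s
    proof -
      have ds: "u s \<in> frac_dom e lam \<sigma>" and dt: "u t \<in> frac_dom e lam \<sigma>" using dom s t by auto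
      note d = frac_norm_diff(1)[OF ds dt]
      show ?thesis
        using frac_norm_add(2)[OF d dt] frac_norm_diff(2)[OF ds d]
          frac_norm_add(2)[OF frac_norm_scaleR(1)[OF d, of "-1"] ds]
          frac_norm_scaleR(2)[OF d, of "-1"] by simp
    qed
    have "((\<lambda>s. frac_norm e lam \<sigma> (u s - u t)) \<longlongrightarrow> 0) (at t within {0..T})"
      by (rule tendsto_within_subset[OF cont]) (use t in auto)
    then have "((\<lambda>s. frac_norm e lam \<sigma> (u s) - frac_norm e lam \<sigma> (u t)) \<longlongrightarrow> 0) (at t within {0..T})"
      by (rule Lim_null_comparison[rotated])
         (auto simp: eventually_at_filter intro!: always_eventually diff)
    then show "((\<lambda>t. frac_norm e lam \<sigma> (u t)) \<longlongrightarrow> frac_norm e lam \<sigma> (u t)) (at t within {0..T})"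
      by (simp add: LIM_zero_iff)
  qed
  then have "compact ((\<lambda>t. frac_norm e lam \<sigma> (u t)) ` {0..T})"
    by (rule compact_continuous_image) (rule compact_Icc)
  from bounded_real[THEN iffD1, OF compact_imp_bounded[OF this]]
  obtain B where B: "\<forall>y\<in>(\<lambda>t. frac_norm e lam \<sigma> (u t)) ` {0..T}. \<bar>y\<bar> \<le> B" by auto
  show thesis
  proof (rule that[of "\<bar>B\<bar>"])
    show "frac_norm e lam \<sigma> (u t) \<le> \<bar>B\<bar>" if "t \<in> {0..T}" for t
      using B[rule_format, OF imageI[OF that]] by linarith
  qed simp
qed

text \<open>F is continuous only for \<open>frac_norm\<close> on \<open>frac_dom\<close>, while
  \<open>a\<close> is merely measurable. Decoupling the two arguments gives a jointly continuous map
  of the plane into H, which is then composed with the measurable curve s \<mapsto> (a s,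
  s).\<close>

lemma nonlinearity_measurable:
  fixes F :: "'h \<Rightarrow> 'h" and L :: real and u :: "real \<Rightarrow> 'h"
  assumes lip: "\<And>u1 u2. u1 \<in> frac_dom e lam \<sigma> \<Longrightarrow> u2 \<in> frac_dom e lam \<sigma> \<Longrightarrow>
            norm (F u1 - F u2) \<le> L * frac_norm e lam \<sigma> (u1 - u2)"
    and dom: "\<And>t. 0 \<le> t \<Longrightarrow> u t \<in> frac_dom e lam \<sigma>"
    and cont: "\<And>t. 0 \<le> t \<Longrightarrow> ((\<lambda>s. frac_norm e lam \<sigma> (u s - u t)) \<longlongrightarrow> 0) (at t within {0..})"
    and a [measurable]: "a \<in> borel_measurable borel"
  shows "set_borel_measurable lborel {0..T} (\<lambda>s. F (a s *\<^sub>R u s))"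
proof -
  \<comment> \<open>The maximum with 0 extends \<open>u\<close> continuously to negative
    times.\<close>
  define G where "G p = F (fst p *\<^sub>R u (max 0 (snd p)))" for p :: "real \<times> real"
  have "isCont G q" for q
    unfolding isCont_def
  proof (rule LIM_zero_cancel, rule Lim_null_comparison)
    let ?m = "\<lambda>p::real \<times> real. max 0 (snd p)"
    have m: "(?m \<longlongrightarrow> ?m q) (at q)" by (intro tendsto_intros)
    \<comment> \<open>The composition needs continuity at the point, not just a punctured limit,
      because \<open>?m p\<close> may equal \<open>?m q\<close> for p \<noteq> q; the value there is
      \<open>frac_norm\<close> of 0.\<close>
    have "continuous (at (?m q) within {0..}) (\<lambda>s. frac_norm e lam \<sigma> (u s - u (?m q)))"
      using cont[of "?m q"] by (simp add: continuous_within frac_norm_zero)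
    from continuous_within_tendsto_compose'[OF this _ m]
    have "((\<lambda>p. frac_norm e lam \<sigma> (u (?m p) - u (?m q))) \<longlongrightarrow> 0) (at q)"
      by (simp add: frac_norm_zero)
    then have "((\<lambda>p. frac_norm e lam \<sigma> (fst p *\<^sub>R u (?m p) - fst q *\<^sub>R u (?m q))) \<longlongrightarrow> 0) (at q)"
      by (intro frac_norm_scaled_tendsto tendsto_intros) (auto intro!: dom always_eventually)
    from tendsto_mult_right_zero[OF this, of L]
    show "((\<lambda>p. L * frac_norm e lam \<sigma> (fst p *\<^sub>R u (?m p) - fst q *\<^sub>R u (?m q))) \<longlongrightarrow> 0) (at q)" .
    show "eventually (\<lambda>p. norm (G p - G q)
        \<le> L * frac_norm e lam \<sigma> (fst p *\<^sub>R u (?m p) - fst q *\<^sub>R u (?m q))) (at q)"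
      unfolding G_def by (intro always_eventually allI lip frac_norm_scaleR dom) auto
  qed
  then have G [measurable]: "G \<in> borel_measurable borel"
    by (intro borel_measurable_continuous_onI continuous_at_imp_continuous_on) auto
  have "(\<lambda>s. G (a s, s)) \<in> borel_measurable borel"
    by (rule measurable_compose[OF _ G]) (simp add: borel_prod[symmetric])
  then have "(\<lambda>s. indicator {0..T} s *\<^sub>R G (a s, s)) \<in> borel_measurable lborel" by measurable
  moreover have "indicator {0..T} s *\<^sub>R G (a s, s) = indicator {0..T} s *\<^sub>R F (a s *\<^sub>R u s)" for s
    by (auto simp: G_def indicator_def)
  ultimately show ?thesis unfolding set_borel_measurable_def by simp
qed

text \<open>The factor e^(-z_s) of the conjugated nonlinearity, the exponential of the integral of z
  and the outer e^(z_t) combine into the path multiplier, while e^(z_s) u(s) = V s inside F. For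
  path regularity, \<open>u\<close> is continuous, so jumps come only from e^z: the left limit at t
  is e^l u(t) with l the left limit of z.\<close>

lemma sde_solution_duhamel:
  fixes F :: "'h \<Rightarrow> 'h" and L :: real
  assumes lip: "\<And>u1 u2. u1 \<in> frac_dom e lam \<sigma> \<Longrightarrow> u2 \<in> frac_dom e lam \<sigma> \<Longrightarrow>
            norm (F u1 - F u2) \<le> L * frac_norm e lam \<sigma> (u1 - u2)"
    and path: "driving_path \<xi>" and V: "sde_solution e lam \<sigma> F \<xi> x V"
  shows "duhamel_solution \<sigma> F T \<xi> x V" and "V \<in> cadlag_space e lam \<sigma> T"
proof -
  interpret driving \<xi> by unfold_locales (rule path)
  let ?z = "ou_process \<xi>"
  from V obtain u where u: "mild_solution e lam \<sigma> F \<xi> (exp (- ?z 0) *\<^sub>R x) u"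
    and Vu: "\<And>t. 0 \<le> t \<Longrightarrow> V t = exp (?z t) *\<^sub>R u t"
    by (auto simp: sde_solution_def)
  have dom: "u t \<in> frac_dom e lam \<sigma>"
    and cont: "((\<lambda>s. frac_norm e lam \<sigma> (u s - u t)) \<longlongrightarrow> 0) (at t within {0..})"
    and u_eq: "u t = exp (LBINT r:{0..t}. ?z r) *\<^sub>R semigroup_exp e lam t (exp (- ?z 0) *\<^sub>R x) +
        (LBINT s:{0..t}. exp (LBINT r:{s..t}. ?z r) *\<^sub>R
           semigroup_exp e lam (t - s) (conj_nonlinearity F \<xi> s (u s)))" if "0 \<le> t" for t
    using u that by (auto simp: mild_solution_def)
  have V_dom: "V t \<in> frac_dom e lam \<sigma>" if "0 \<le> t" for t
    using Vu[OF that] frac_norm_scaleR(1)[OF dom[OF that]] by simp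
  have \<xi>0: "\<xi> 0 = 0" using path by (simp add: driving_path_def)
  show "duhamel_solution \<sigma> F T \<xi> x V"
    unfolding duhamel_solution_def
  proof (intro conjI ballI)
    show "V t \<in> frac_dom e lam \<sigma>" if "t \<in> {0..T}" for t using V_dom that by simp
    show "\<exists>B. \<forall>t\<in>{0..T}. frac_norm e lam \<sigma> (V t) \<le> B"
    proof -
      obtain B where B: "0 \<le> B" "\<And>t. t \<in> {0..T} \<Longrightarrow> frac_norm e lam \<sigma> (u t) \<le> B"
        using frac_continuous_bounded[OF dom cont] by blast
      obtain Z where Z: "0 \<le> Z" "\<And>t. t \<in> {0..T} \<Longrightarrow> \<bar>?z t\<bar> \<le> Z" using bounded_ou by blast
      have "frac_norm e lam \<sigma> (V t) \<le> exp Z * B" if t: "t \<in> {0..T}" for t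
      proof -
        have t0: "0 \<le> t" using t by simp
        have "frac_norm e lam \<sigma> (V t) \<le> \<bar>exp (?z t)\<bar> * frac_norm e lam \<sigma> (u t)"
          unfolding Vu[OF t0] by (rule frac_norm_scaleR(2)[OF dom[OF t0]])
        also have "\<dots> \<le> exp Z * B"
          using Z(2)[OF t] B(2)[OF t] by (intro mult_mono) (auto simp: frac_norm_nonneg)
        finally show ?thesis .
      qed
      then show ?thesis by blast
    qed
    have "set_borel_measurable lborel {0..T} (\<lambda>s. F (exp (?z s) *\<^sub>R u s))"
      by (rule nonlinearity_measurable[OF lip dom cont]) auto
    moreover have "indicator {0..T} s *\<^sub>R F (exp (?z s) *\<^sub>R u s) = indicator {0..T} s *\<^sub>R F (V s)" for s
      using Vu[of s] by (auto simp: indicator_def)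
    ultimately show "set_borel_measurable lborel {0..T} (\<lambda>s. F (V s))"
      unfolding set_borel_measurable_def by simp
    fix t assume "t \<in> {0..T}"
    then have t: "0 \<le> t" by simp
    have mult: "exp (?z t) * exp (LBINT r:{s..t}. ?z r) * exp (- ?z s) = exp (\<xi> t - \<xi> s)"
      if "s \<le> t" for s
      using ou_process_increment[OF that]
      unfolding exp_add[symmetric] by (intro arg_cong[of _ _ exp]) linarith
    have "exp (?z t) *\<^sub>R exp (LBINT r:{0..t}. ?z r) *\<^sub>R semigroup_exp e lam t (exp (- ?z 0) *\<^sub>R x)
        = exp (\<xi> t) *\<^sub>R semigroup_exp e lam t x"
      using mult[OF t] \<xi>0 by (simp add: semigroup_scaleR[OF t])
    moreover have "exp (?z t) *\<^sub>R (LBINT s:{0..t}. exp (LBINT r:{s..t}. ?z r) *\<^sub>R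
           semigroup_exp e lam (t - s) (conj_nonlinearity F \<xi> s (u s)))
        = (LBINT s:{0..t}. semigroup_exp e lam (t - s) (exp (\<xi> t - \<xi> s) *\<^sub>R F (V s)))"
    proof (subst set_integral_scaleR_right[symmetric], intro set_lebesgue_integral_cong allI impI)
      fix s assume s: "s \<in> {0..t}"
      then show "exp (?z t) *\<^sub>R exp (LBINT r:{s..t}. ?z r) *\<^sub>R
           semigroup_exp e lam (t - s) (conj_nonlinearity F \<xi> s (u s))
          = semigroup_exp e lam (t - s) (exp (\<xi> t - \<xi> s) *\<^sub>R F (V s))"
        using mult[of s] Vu[of s] by (simp add: conj_nonlinearity_def semigroup_scaleR)
    qed simp
    ultimately show "V t = exp (\<xi> t) *\<^sub>R semigroup_exp e lam t x +
        (LBINT s:{0..t}. semigroup_exp e lam (t - s) (exp (\<xi> t - \<xi> s) *\<^sub>R F (V s)))"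
      unfolding Vu[OF t] by (subst u_eq[OF t]) (simp only: scaleR_add_right)
  qed
  show "V \<in> cadlag_space e lam \<sigma> T"
    unfolding cadlag_space_def
  proof (intro CollectI conjI ballI)
    show "V t \<in> frac_dom e lam \<sigma>" if "t \<in> {0..T}" for t using V_dom that by simp
  next
    fix t assume "t \<in> {0..<T}"
    then have t: "0 \<le> t" by simp
    have pos: "eventually (\<lambda>s. 0 \<le> s) (at_right t)"
      using t by (auto simp: eventually_at_filter)
    have "((\<lambda>s. frac_norm e lam \<sigma> (u s - u t)) \<longlongrightarrow> 0) (at_right t)"
      by (rule tendsto_within_subset[OF cont[OF t]]) (use t in auto)
    then have "((\<lambda>s. frac_norm e lam \<sigma> (exp (?z s) *\<^sub>R u s - exp (?z t) *\<^sub>R u t)) \<longlongrightarrow> 0) (at_right t)"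
      by (intro frac_norm_scaled_tendsto tendsto_intros ou_right_continuous dom t eventually_mono[OF pos])
    then show "((\<lambda>s. frac_norm e lam \<sigma> (V s - V t)) \<longlongrightarrow> 0) (at_right t)"
      by (rule Lim_transform_eventually) (rule eventually_mono[OF pos], simp add: Vu t)
  next
    fix t assume "t \<in> {0<..T}"
    then have t: "0 < t" by simp
    obtain l where l: "(?z \<longlongrightarrow> l) (at_left t)" using ou_left_limit by blast
    have pos: "eventually (\<lambda>s. 0 \<le> s) (at_left t)"
      using eventually_at_left_real[OF t] by eventually_elim simp
    have "((\<lambda>s. frac_norm e lam \<sigma> (u s - u t)) \<longlongrightarrow> 0) (at t)"
      using cont[of t] t at_within_interior[of t "{0..}"] by (simp add: interior_Ici)
    then have "((\<lambda>s. frac_norm e lam \<sigma> (u s - u t)) \<longlongrightarrow> 0) (at_left t)"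
      by (rule filterlim_mono) (auto intro: at_le)
    then have "((\<lambda>s. frac_norm e lam \<sigma> (exp (?z s) *\<^sub>R u s - exp l *\<^sub>R u t)) \<longlongrightarrow> 0) (at_left t)"
      using t by (intro frac_norm_scaled_tendsto tendsto_intros l dom eventually_mono[OF pos]) auto
    then have "((\<lambda>s. frac_norm e lam \<sigma> (V s - exp l *\<^sub>R u t)) \<longlongrightarrow> 0) (at_left t)"
      by (rule Lim_transform_eventually) (rule eventually_mono[OF pos], simp add: Vu)
    moreover have "exp l *\<^sub>R u t \<in> frac_dom e lam \<sigma>"
      using t by (intro frac_norm_scaleR dom) simp
    ultimately show "\<exists>l\<in>frac_dom e lam \<sigma>. ((\<lambda>s. frac_norm e lam \<sigma> (V s - l)) \<longlongrightarrow> 0) (at_left t)"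
      by blast
  qed
qed

end

section \<open>Convergence of the noise in probability\<close>

text \<open>On (0,1], 1 - e^(-qy) is close to q y, and integrating the latter against the Levy
  density gives q c / (1 - a). Everything else is at most c times a constant uniform in a > 1/2,
  hence negligible when c tends to 0 with c / (1 - a) fixed.\<close>

lemma laplace_exponent_bound:
  fixes q :: real
  assumes q: "0 \<le> q"
  obtains D where "\<And>a c. 1 / 2 < a \<Longrightarrow> a < 1 \<Longrightarrow> 0 \<le> c \<Longrightarrow>
    \<bar>(LBINT y:{0<..}. (1 - exp (- q * y)) * (c * y powr (- 1 - a))) - q * (c / (1 - a))\<bar> \<le> c * D"
proof -
  \<comment> \<open>On (0,1] the quadratic error (q y)^2 meets y^(-1-a), leaving q^2 y^(1-a) \<le>
    q^2; on [1,\<infinity>) the density is at most y^(-3/2) because a > 1/2.\<close>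
  define g where "g y = indicator {0..1} y * q\<^sup>2 + indicator {1..} y * y powr (- 3 / 2)" for y :: real
  have "set_integrable lborel {1..} (\<lambda>y. y powr (- 3 / 2) :: real)"
    using has_integral_powr_to_inf[of "- 3 / 2" 1]
    by (intro set_integrable_lborel_nonneg) auto
  then have g_int: "integrable lborel g"
    unfolding g_def set_integrable_def by (intro Bochner_Integration.integrable_add) auto
  define D where "D = (LINT y|lborel. g y)"
  show thesis
  proof (rule that[of D])
    fix a c :: real assume a: "1 / 2 < a" "a < 1" and c: "0 \<le> c"
    define f where "f y = indicator {0..1} y * y powr (- a)" for y :: real
    define k where "k y = indicator {0<..} y * ((1 - exp (- q * y)) * y powr (- 1 - a))" for y :: real
    have hf: "((\<lambda>y. y powr (- a)) has_integral 1 / (1 - a)) {0..1}"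
      using has_integral_powr_from_0[of "- a" 1] a by (simp add: algebra_simps)
    have si: "set_integrable lborel {0..1} (\<lambda>y. y powr (- a))"
      by (rule set_integrable_lborel_nonneg) (use hf in auto)
    have f_int: "integrable lborel f" using si by (simp add: f_def[abs_def] set_integrable_def)
    have f_val: "(LINT y|lborel. f y) = 1 / (1 - a)"
      using set_borel_integral_eq_integral(2)[OF si] integral_unique[OF hf]
      by (simp add: f_def set_lebesgue_integral_def)
    have k_meas: "k \<in> borel_measurable lborel" unfolding k_def by measurable
    have diff: "\<bar>k y - q * f y\<bar> \<le> g y" for y
    proof -
      have pw: "y * y powr (- 1 - a) = y powr (- a)" if "0 < y"
        using powr_add[of y 1 "- 1 - a"] that by simp
      consider "y \<le> 0" | "0 < y" "y \<le> 1" | "1 < y" by linarith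
      then show ?thesis
      proof cases
        case 1
        then show ?thesis by (cases "y = 0") (auto simp: k_def f_def g_def)
      next
        case 2
        define x where "x = q * y"
        have x: "0 \<le> x" using q 2 by (simp add: x_def)
        have up: "1 - exp (- x) \<le> x" using exp_ge_add_one_self[of "- x"] by linarith
        \<comment> \<open>Proves e^(-x) \<le> 1 - x + x^2 by multiplying with 1 + x, since (1 - x +
          x^2)(1 + x) = 1 + x^3.\<close>
        have "exp (- x) * (1 + x) \<le> exp (- x) * exp x"
          using x by (intro mult_left_mono exp_ge_add_one_self) auto
        also have "\<dots> = 1" by (simp flip: exp_add)
        also have "\<dots> \<le> (1 - x + x\<^sup>2) * (1 + x)"
          using x by (simp add: algebra_simps power2_eq_square)
        finally have "exp (- x) \<le> 1 - x + x\<^sup>2" using x by (simp add: mult_le_cancel_right)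
        with up have ab: "\<bar>1 - exp (- x) - x\<bar> \<le> x\<^sup>2" by linarith
        have "k y - q * f y = (1 - exp (- x) - x) * y powr (- 1 - a)"
          using 2 pw by (simp add: k_def f_def x_def algebra_simps)
        then have "\<bar>k y - q * f y\<bar> = \<bar>1 - exp (- x) - x\<bar> * y powr (- 1 - a)" by (simp add: abs_mult)
        also have "\<dots> \<le> x\<^sup>2 * y powr (- 1 - a)" using ab by (intro mult_right_mono) auto
        also have "x\<^sup>2 * y powr (- 1 - a) = q\<^sup>2 * (y * (y * y powr (- 1 - a)))"
          by (simp add: x_def power2_eq_square)
        also have "y * (y * y powr (- 1 - a)) = y powr (1 - a)"
          using pw 2 powr_add[of y 1 "- a"] by simp
        also have "q\<^sup>2 * y powr (1 - a) \<le> q\<^sup>2 * 1"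
          using 2 a by (intro mult_left_mono powr_le1) auto
        finally show ?thesis using 2 by (auto simp: g_def indicator_def)
      next
        case 3
        have "0 \<le> q * y" using q 3 by simp
        then have "(1 - exp (- q * y)) * y powr (- 1 - a) \<le> 1 * y powr (- 3 / 2)"
          using 3 a by (intro mult_mono powr_mono) auto
        moreover have "0 \<le> (1 - exp (- q * y)) * y powr (- 1 - a)" using \<open>0 \<le> q * y\<close> by simp
        ultimately show ?thesis using 3 by (simp add: k_def f_def g_def)
      qed
    qed
    have d_int: "integrable lborel (\<lambda>y. k y - q * f y)"
    proof (rule Bochner_Integration.integrable_bound[OF g_int])
      show "(\<lambda>y. k y - q * f y) \<in> borel_measurable lborel"
        using k_meas f_int by measurable
      show "AE y in lborel. norm (k y - q * f y) \<le> norm (g y)"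
        using diff by (intro AE_I2) (metis abs_ge_self order_trans real_norm_def)
    qed
    have "integrable lborel (\<lambda>y. (k y - q * f y) + q * f y)"
      by (intro Bochner_Integration.integrable_add d_int integrable_mult_right f_int)
    then have k_int: "integrable lborel k" by simp
    have "\<bar>(LINT y|lborel. k y - q * f y)\<bar> \<le> (LINT y|lborel. g y)"
      using Bochner_Integration.integral_norm_bound_integral[OF d_int g_int] diff by simp
    moreover have "(LINT y|lborel. k y - q * f y) = (LINT y|lborel. k y) - q * (1 / (1 - a))"
      using Bochner_Integration.integral_diff[OF k_int integrable_mult_right[OF f_int, of q]] f_val by simp
    ultimately have bd: "\<bar>(LINT y|lborel. k y) - q * (1 / (1 - a))\<bar> \<le> D" by (simp add: D_def)
    have "(LBINT y:{0<..}. (1 - exp (- q * y)) * (c * y powr (- 1 - a))) = (LINT y|lborel. c * k y)"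
      unfolding set_lebesgue_integral_def by (intro Bochner_Integration.integral_cong) (auto simp: k_def)
    also have "\<dots> = c * (LINT y|lborel. k y)" by simp
    finally have "(LBINT y:{0<..}. (1 - exp (- q * y)) * (c * y powr (- 1 - a))) - q * (c / (1 - a))
        = c * ((LINT y|lborel. k y) - q * (1 / (1 - a)))" by (simp add: algebra_simps)
    then show "\<bar>(LBINT y:{0<..}. (1 - exp (- q * y)) * (c * y powr (- 1 - a))) - q * (c / (1 - a))\<bar>
        \<le> c * D"
      using mult_left_mono[OF bd c] c by (simp add: abs_mult)
  qed
qed

lemma eventually_at_left_2: "eventually (\<lambda>\<alpha>. \<alpha> \<in> {1<..<2::real}) (at_left 2)"
  by (rule eventually_at_left_real) simp

text \<open>With a = \<alpha>/2 the main term is q times the ratio assumed to tend to 1, and the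
  error is of order C \<alpha>, which is that ratio times (2 - \<alpha>)/2 and so vanishes.\<close>

lemma laplace_exponent_tendsto:
  fixes C :: "real \<Rightarrow> real" and q :: real
  assumes C_pos: "\<And>\<alpha>. \<alpha> \<in> {1<..<2} \<Longrightarrow> C \<alpha> > 0"
    and C_lim: "((\<lambda>\<alpha>. 2 * C \<alpha> / (2 - \<alpha>)) \<longlongrightarrow> 1) (at_left 2)" and q: "0 \<le> q"
  shows "((\<lambda>\<alpha>. LBINT y:{0<..}. (1 - exp (- q * y)) * (C \<alpha> * y powr (- 1 - \<alpha> / 2))) \<longlongrightarrow> q) (at_left 2)"
    (is "(?\<psi> \<longlongrightarrow> q) _")
proof -
  obtain D where D: "\<And>a c. 1 / 2 < a \<Longrightarrow> a < 1 \<Longrightarrow> 0 \<le> c \<Longrightarrow>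
    \<bar>(LBINT y:{0<..}. (1 - exp (- q * y)) * (c * y powr (- 1 - a))) - q * (c / (1 - a))\<bar> \<le> c * D"
    by (rule laplace_exponent_bound[OF q]) (rule that)
  let ?r = "\<lambda>\<alpha>. 2 * C \<alpha> / (2 - \<alpha>)"
  have "((\<lambda>\<alpha>. ?r \<alpha> * ((2 - \<alpha>) / 2) * D) \<longlongrightarrow> 1 * ((2 - 2) / 2) * D) (at_left 2)"
    by (intro tendsto_intros C_lim) simp
  then have lim0: "((\<lambda>\<alpha>. ?r \<alpha> * ((2 - \<alpha>) / 2) * D) \<longlongrightarrow> 0) (at_left 2)" by simp
  have "eventually (\<lambda>\<alpha>. norm (?\<psi> \<alpha> - q * ?r \<alpha>) \<le> ?r \<alpha> * ((2 - \<alpha>) / 2) * D) (at_left 2)"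
    using eventually_at_left_2
  proof eventually_elim
    case (elim \<alpha>)
    have "C \<alpha> / (1 - \<alpha> / 2) = ?r \<alpha>" "?r \<alpha> * ((2 - \<alpha>) / 2) = C \<alpha>"
      using elim by (auto simp: field_simps)
    then show ?case using D[of "\<alpha> / 2" "C \<alpha>"] C_pos[OF elim] elim by simp
  qed
  from Lim_null_comparison[OF this lim0]
  have "((\<lambda>\<alpha>. ?\<psi> \<alpha> - q * ?r \<alpha>) \<longlongrightarrow> 0) (at_left 2)" .
  from tendsto_add[OF this tendsto_mult[OF tendsto_const[of q] C_lim]]
  show ?thesis by simp
qed

section \<open>Deviation of the subordinator from the identity\<close>

lemma path_algebra_coordinate:
  assumes "sets \<mu> = sets (path_algebra X)"
  shows "(\<lambda>\<xi>. \<xi> t) \<in> borel_measurable \<mu>" and "space \<mu> = X"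
proof -
  have "(\<lambda>\<xi>. \<xi> t) \<in> borel_measurable (path_algebra X)"
    unfolding path_algebra_def
    by (intro measurable_restrict_space1 measurable_component_singleton) simp
  then show "(\<lambda>\<xi>. \<xi> t) \<in> borel_measurable \<mu>"
    by (simp cong: measurable_cong_sets add: measurable_cong_sets[OF assms refl])
  show "space \<mu> = X"
    using sets_eq_imp_space_eq[OF assms] by (simp add: path_algebra_def space_restrict_space space_PiM)
qed

text \<open>
  \<open>S\<^sub>t\<close> has infinite mean, so Markov's inequality is applied to \<open>(exp (- S\<^sub>t) - exp (- t))\<^sup>2\<close>, whose
  expectation the Laplace transform gives at \<open>q = 1\<close> and \<open>q = 2\<close>.
\<close>
lemma subordinator_deviation:
  assumes S: "stable_subordinator_measure a c \<mu>" and t: "0 < t" and \<delta>: "0 < \<delta>"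
  defines "\<psi> \<equiv> \<lambda>q. LBINT y:{0<..}. (1 - exp (- q * y)) * (c * y powr (- 1 - a))"
  shows "emeasure \<mu> {ell \<in> subordinator_paths. \<delta> < \<bar>ell t - t\<bar>}
      \<le> ennreal (1 / (exp (- t) * (1 - exp (- \<delta>)))\<^sup>2 *
          (exp (- t * \<psi> 2) - 2 * exp (- t) * exp (- t * \<psi> 1) + exp (- 2 * t)))"
proof -
  interpret prob_space \<mu> using S by (simp add: stable_subordinator_measure_def)
  have sets: "sets \<mu> = sets (path_algebra subordinator_paths)"
    using S by (simp add: stable_subordinator_measure_def)
  note [measurable] = path_algebra_coordinate(1)[OF sets]
  note sp = path_algebra_coordinate(2)[OF sets]
  have zero: "ell 0 = 0" and nonneg: "0 \<le> ell t" if "ell \<in> space \<mu>" for ell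
  proof -
    have ell: "ell \<in> subordinator_paths" using that sp by simp
    show "ell 0 = 0" using subordinator_at_0[OF ell] .
    then show "0 \<le> ell t" using ell t monoD[of ell 0 t] by (simp add: subordinator_paths_def)
  qed
  have laplace: "(LINT ell|\<mu>. exp (- q * ell t)) = exp (- t * \<psi> q)" if q: "0 \<le> q" for q
  proof -
    have "(LINT ell|\<mu>. exp (- q * ell t)) = (LINT ell|\<mu>. exp (- q * (ell t - ell 0)))"
      by (intro Bochner_Integration.integral_cong) (auto simp: zero)
    also have "\<dots> = exp (- (t - 0) * \<psi> q)"
      using S t q unfolding stable_subordinator_measure_def \<psi>_def by blast
    finally show ?thesis by simp
  qed
  have int: "integrable \<mu> (\<lambda>ell. exp (- q * ell t))" if "0 \<le> q" for q
    by (rule integrable_const_bound[of _ 1]) (use that nonneg in auto)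
  define u where "u ell = (exp (- ell t) - exp (- t))\<^sup>2" for ell :: "real \<Rightarrow> real"
  have u_eq: "u ell = exp (- 2 * ell t) - 2 * exp (- t) * exp (- 1 * ell t) + exp (- 2 * t)" for ell
    by (simp add: u_def power2_eq_square algebra_simps flip: exp_add)
  have u_int: "integrable \<mu> u"
    unfolding u_eq[abs_def] by (intro Bochner_Integration.integrable_add Bochner_Integration.integrable_diff
      integrable_mult_right int) auto
  have u_val: "(LINT ell|\<mu>. u ell) = exp (- t * \<psi> 2) - 2 * exp (- t) * exp (- t * \<psi> 1) + exp (- 2 * t)"
  proof -
    have i2: "integrable \<mu> (\<lambda>ell. exp (- 2 * ell t))" by (rule int) simp
    have i1: "integrable \<mu> (\<lambda>ell. 2 * exp (- t) * exp (- 1 * ell t))"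
      by (intro integrable_mult_right int) simp
    have "(LINT ell|\<mu>. u ell) = (LINT ell|\<mu>. exp (- 2 * ell t))
        - (LINT ell|\<mu>. 2 * exp (- t) * exp (- 1 * ell t)) + (LINT ell|\<mu>. exp (- 2 * t))"
      unfolding u_eq
      by (simp only: Bochner_Integration.integral_add[OF Bochner_Integration.integrable_diff[OF i2 i1] integrable_const]
          Bochner_Integration.integral_diff[OF i2 i1])
    then show ?thesis
      using laplace[of 2] laplace[of 1] by (simp add: prob_space)
  qed
  \<comment> \<open>A lower bound for |e^(-S) - e^(-t)| when |S - t| > \<delta>, attained in the
    limit S = t + \<delta>. For S below t - \<delta> the gap is larger, because e^\<delta> +
    e^(-\<delta>) \<ge> 2.\<close>
  define \<kappa> where "\<kappa> = exp (- t) * (1 - exp (- \<delta>))"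
  have \<kappa>: "0 < \<kappa>" using \<delta> by (simp add: \<kappa>_def)
  have dev: "\<kappa>\<^sup>2 \<le> u ell" if "\<delta> < \<bar>ell t - t\<bar>" for ell :: "real \<Rightarrow> real"
  proof -
    have "\<kappa> \<le> \<bar>exp (- ell t) - exp (- t)\<bar>"
    proof (cases "t + \<delta> < ell t")
      case True
      then have "exp (- ell t) \<le> exp (- t) * exp (- \<delta>)" by (simp flip: exp_add)
      then show ?thesis using True \<delta> by (simp add: \<kappa>_def algebra_simps abs_if)
    next
      case False
      then have "exp (- t) * exp \<delta> \<le> exp (- ell t)" using that by (simp flip: exp_add)
      moreover have "2 \<le> exp \<delta> + exp (- \<delta>)"
        using exp_ge_add_one_self[of \<delta>] exp_ge_add_one_self[of "- \<delta>"] by linarith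
      from mult_left_mono[OF this, of "exp (- t)"]
      have "2 * exp (- t) \<le> exp (- t) * exp \<delta> + exp (- t) * exp (- \<delta>)" by (simp add: algebra_simps)
      ultimately show ?thesis using False that by (simp add: \<kappa>_def algebra_simps abs_if split: if_splits)
    qed
    then show ?thesis unfolding u_def using \<kappa> by (metis less_imp_le power2_abs power_mono)
  qed
  have "emeasure \<mu> {ell \<in> subordinator_paths. \<delta> < \<bar>ell t - t\<bar>} \<le> emeasure \<mu> {ell \<in> space \<mu>. \<kappa>\<^sup>2 \<le> u ell}"
  proof (rule emeasure_mono)
    show "{ell \<in> space \<mu>. \<kappa>\<^sup>2 \<le> u ell} \<in> sets \<mu>" unfolding u_def by measurable
  qed (use dev sp in auto)
  also have "\<dots> \<le> ennreal (1 / \<kappa>\<^sup>2 * (LINT ell|\<mu>. u ell))"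
    by (rule integral_Markov_inequality[OF u_int]) (use \<kappa> in \<open>auto simp: u_def\<close>)
  finally show ?thesis by (simp only: u_val \<kappa>_def)
qed

text \<open>The Markov bound is continuous in the two Laplace exponents, and at their limits 2 and 1
  its last factor is the expanded square of e^(-t) - e^(-t).\<close>

lemma subordinator_pointwise:
  fixes C :: "real \<Rightarrow> real"
  assumes C_pos: "\<And>\<alpha>. \<alpha> \<in> {1<..<2} \<Longrightarrow> C \<alpha> > 0"
    and C_lim: "((\<lambda>\<alpha>. 2 * C \<alpha> / (2 - \<alpha>)) \<longlongrightarrow> 1) (at_left 2)"
    and S: "\<And>\<alpha>. \<alpha> \<in> {1<..<2} \<Longrightarrow> stable_subordinator_measure (\<alpha> / 2) (C \<alpha>) (\<mu>S \<alpha>)"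
    and t: "0 < t" and \<delta>: "0 < \<delta>"
  shows "((\<lambda>\<alpha>. emeasure (\<mu>S \<alpha>) {ell \<in> subordinator_paths. \<delta> < \<bar>ell t - t\<bar>}) \<longlongrightarrow> 0) (at_left 2)"
proof -
  define \<psi> where "\<psi> \<alpha> q = (LBINT y:{0<..}. (1 - exp (- q * y)) * (C \<alpha> * y powr (- 1 - \<alpha> / 2)))" for \<alpha> q
  define b where "b \<alpha> = 1 / (exp (- t) * (1 - exp (- \<delta>)))\<^sup>2 *
          (exp (- t * \<psi> \<alpha> 2) - 2 * exp (- t) * exp (- t * \<psi> \<alpha> 1) + exp (- 2 * t))" for \<alpha>
  have \<psi>: "((\<lambda>\<alpha>. \<psi> \<alpha> q) \<longlongrightarrow> q) (at_left 2)" if "0 \<le> q" for q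
    unfolding \<psi>_def by (rule laplace_exponent_tendsto[OF C_pos C_lim that])
  have "(b \<longlongrightarrow> 1 / (exp (- t) * (1 - exp (- \<delta>)))\<^sup>2 *
          (exp (- t * 2) - 2 * exp (- t) * exp (- t * 1) + exp (- 2 * t))) (at_left 2)"
    unfolding b_def by (intro tendsto_intros \<psi>) auto
  moreover have "exp (- t * 2) - 2 * exp (- t) * exp (- t * 1) + exp (- 2 * t) = 0"
    by (simp add: mult_ac flip: exp_add)
  ultimately have "(b \<longlongrightarrow> 0) (at_left 2)" by simp
  from tendsto_ennrealI[OF this] have lim: "((\<lambda>\<alpha>. ennreal (b \<alpha>)) \<longlongrightarrow> 0) (at_left 2)" by simp
  show ?thesis
  proof (rule tendsto_sandwich[OF _ _ tendsto_const lim])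
    show "eventually (\<lambda>\<alpha>. emeasure (\<mu>S \<alpha>) {ell \<in> subordinator_paths. \<delta> < \<bar>ell t - t\<bar>}
        \<le> ennreal (b \<alpha>)) (at_left 2)"
      using eventually_at_left_2
      by eventually_elim (unfold b_def \<psi>_def, rule subordinator_deviation[OF S t \<delta>])
  qed simp
qed

text \<open>A monotone path within \<delta>/4 of the identity on a grid of mesh at most \<delta>/2
  is within 3\<delta>/4 of it in between. \<open>B\<close> collects the paths that fail at some grid
  point: one set for all \<alpha>, with measure at most a finite sum of vanishing
  probabilities.\<close>

lemma subordinator_uniform:
  fixes C :: "real \<Rightarrow> real"
  assumes C_pos: "\<And>\<alpha>. \<alpha> \<in> {1<..<2} \<Longrightarrow> C \<alpha> > 0"
    and C_lim: "((\<lambda>\<alpha>. 2 * C \<alpha> / (2 - \<alpha>)) \<longlongrightarrow> 1) (at_left 2)"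
    and S: "\<And>\<alpha>. \<alpha> \<in> {1<..<2} \<Longrightarrow> stable_subordinator_measure (\<alpha> / 2) (C \<alpha>) (\<mu>S \<alpha>)"
    and T: "0 < T" and \<delta>: "0 < \<delta>"
  obtains B where "\<And>\<alpha>. \<alpha> \<in> {1<..<2} \<Longrightarrow> B \<in> sets (\<mu>S \<alpha>)"
    and "((\<lambda>\<alpha>. emeasure (\<mu>S \<alpha>) B) \<longlongrightarrow> 0) (at_left 2)"
    and "\<And>ell t. ell \<in> subordinator_paths - B \<Longrightarrow> t \<in> {0..T} \<Longrightarrow> \<bar>ell t - t\<bar> < \<delta>"
proof -
  define n where "n = nat \<lceil>2 * T / \<delta>\<rceil> + 1"
  have n: "0 < n" by (simp add: n_def)
  define h where "h = T / n"
  have h: "0 < h" using T n by (simp add: h_def)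
  have "2 * T / \<delta> \<le> real n" unfolding n_def by linarith
  then have h_le: "h \<le> \<delta> / 2" using \<delta> n by (simp add: h_def field_simps)
  define D where "D i = {ell \<in> subordinator_paths. \<delta> / 4 < \<bar>ell (real i * h) - real i * h\<bar>}" for i
  \<comment> \<open>The index 0 is left out: all paths vanish there, and the pointwise estimate is
    for positive times.\<close>
  define B where "B = (\<Union>i\<in>{1..n}. D i)"
  have D_meas: "D i \<in> sets (\<mu>S \<alpha>)" if "\<alpha> \<in> {1<..<2}" for i \<alpha>
  proof -
    have sets: "sets (\<mu>S \<alpha>) = sets (path_algebra subordinator_paths)"
      using S[OF that] by (simp add: stable_subordinator_measure_def)
    note [measurable] = path_algebra_coordinate(1)[OF sets]
    show ?thesis unfolding D_def path_algebra_coordinate(2)[OF sets, symmetric] by measurable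
  qed
  show thesis
  proof (rule that[of B])
    show "B \<in> sets (\<mu>S \<alpha>)" if "\<alpha> \<in> {1<..<2}" for \<alpha>
      unfolding B_def using D_meas[OF that] by auto
    have "((\<lambda>\<alpha>. emeasure (\<mu>S \<alpha>) (D i)) \<longlongrightarrow> 0) (at_left 2)" if "i \<in> {1..n}" for i
      unfolding D_def by (rule subordinator_pointwise[OF C_pos C_lim S]) (use that h \<delta> in auto)
    then have lim: "((\<lambda>\<alpha>. \<Sum>i\<in>{1..n}. emeasure (\<mu>S \<alpha>) (D i)) \<longlongrightarrow> 0) (at_left 2)"
      by (rule tendsto_null_sum)
    show "((\<lambda>\<alpha>. emeasure (\<mu>S \<alpha>) B) \<longlongrightarrow> 0) (at_left 2)"
    proof (rule tendsto_sandwich[OF _ _ tendsto_const lim])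
      show "eventually (\<lambda>\<alpha>. emeasure (\<mu>S \<alpha>) B \<le> (\<Sum>i\<in>{1..n}. emeasure (\<mu>S \<alpha>) (D i))) (at_left 2)"
        using eventually_at_left_2
        by eventually_elim (unfold B_def, rule emeasure_subadditive_finite, use D_meas in auto)
    qed simp
    fix ell t assume ell: "ell \<in> subordinator_paths - B" and t: "t \<in> {0..T}"
    have mono: "mono ell" using ell by (simp add: subordinator_paths_def)
    have grid: "\<bar>ell (real i * h) - real i * h\<bar> \<le> \<delta> / 4" if "i \<le> n" for i
    proof (cases "i = 0")
      case True
      then show ?thesis using ell subordinator_at_0[of ell] \<delta> by simp
    next
      case False
      then have "i \<in> {1..n}" using that by simp
      then have "ell \<notin> D i" using ell by (auto simp: B_def)
      then show ?thesis using ell by (simp add: D_def not_less)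
    qed
    \<comment> \<open>At t = T the floor would give n, whose successor lies outside the grid; the
      last cell is taken instead.\<close>
    define i where "i = (if t = T then n - 1 else nat \<lfloor>t / h\<rfloor>)"
    have nh: "real n * h = T" using n by (simp add: h_def)
    have i: "Suc i \<le> n" "real i * h \<le> t" "t \<le> real (Suc i) * h"
    proof -
      have 1: "Suc i \<le> n \<and> real i * h \<le> t \<and> t \<le> real (Suc i) * h"
      proof (cases "t = T")
        case True
        then have "Suc i = n" using n by (simp add: i_def)
        moreover have "real i * h \<le> real n * h" using h \<open>Suc i = n\<close> by (intro mult_right_mono) auto
        ultimately show ?thesis using nh True by simp
      next
        case False
        then have ii: "i = nat \<lfloor>t / h\<rfloor>" by (simp add: i_def)
        have th: "0 \<le> t / h" using t h by simp
        have "real i \<le> t / h" "t / h < real i + 1" unfolding ii using th by linarith+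
        then have "real i * h \<le> t" "t < (real i + 1) * h" using h by (simp_all add: field_simps)
        moreover have "real i * h < real n * h" using \<open>real i * h \<le> t\<close> t False nh by simp
        then have "i < n" using h by simp
        ultimately show ?thesis by (simp add: algebra_simps)
      qed
      then show "Suc i \<le> n" "real i * h \<le> t" "t \<le> real (Suc i) * h" by auto
    qed
    have step: "real (Suc i) * h = real i * h + h" by (simp add: algebra_simps)
    have "ell (real i * h) \<le> ell t" "ell t \<le> ell (real (Suc i) * h)"
      using i by (auto intro: monoD[OF mono])
    then show "\<bar>ell t - t\<bar> < \<delta>"
      using grid[OF Suc_leD[OF i(1)]] grid[OF i(1)] i(2,3) step h_le \<delta>
      by (simp only: abs_le_iff abs_less_iff) linarith
  qed
qed

section \<open>Uniform bounds and moduli of continuity for Brownian paths, off small events\<close>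

lemma open_contains_rat:
  fixes U :: "real set"
  assumes "open U" "s \<in> U"
  shows "\<exists>q::rat. of_rat q \<in> U"
proof -
  obtain d where d: "0 < d" "ball s d \<subseteq> U" using assms by (meson openE)
  obtain q :: rat where "s < of_rat q" "of_rat q < s + d" using of_rat_dense[of s "s + d"] d by auto
  then have "of_rat q \<in> ball s d" by (auto simp: dist_real_def)
  then show ?thesis using d by blast
qed

text \<open>Continuity from above of a probability measure. Continuous paths make the bad events
  below shrink to the empty set, which replaces any quantitative estimate on Brownian
  motion.\<close>

lemma wiener_decreasing_events:
  assumes W: "wiener_measure \<mu>" and meas: "\<And>n. A n \<in> sets \<mu>" and dec: "decseq A"
    and emp: "(\<Inter>n. A n) = {}" and r: "0 < (r::ennreal)"
  obtains n :: nat where "emeasure \<mu> (A n) < r"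
proof -
  interpret prob_space \<mu> using W by (simp add: wiener_measure_def)
  have "(\<lambda>n. emeasure \<mu> (A n)) \<longlonglongrightarrow> emeasure \<mu> (\<Inter>n. A n)"
    using meas dec by (intro Lim_emeasure_decseq) auto
  then have "(\<lambda>n. emeasure \<mu> (A n)) \<longlonglongrightarrow> 0" by (simp add: emp)
  from order_tendstoD(2)[OF this r] that show thesis by (auto simp: eventually_sequentially)
qed

text \<open>Testing rational times only makes the events measurable. By continuity an exceedance at
  a real time persists on a neighbourhood, which contains a rational.\<close>

lemma wiener_bounded:
  assumes W: "wiener_measure \<mu>" and r: "0 < (r::ennreal)"
  obtains K A where "A \<in> sets \<mu>" "emeasure \<mu> A < r"
    "\<And>\<omega> s. \<omega> \<in> wiener_paths - A \<Longrightarrow> s \<in> {a..b} \<Longrightarrow> \<bar>\<omega> s\<bar> \<le> K"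
proof -
  \<comment> \<open>An open enlargement of [a,b], so that a rational near an endpoint is still
    tested; compactness is used on its closure.\<close>
  let ?O = "{a - 1<..<b + 1}"
  have sets: "sets \<mu> = sets (path_algebra wiener_paths)" using W by (simp add: wiener_measure_def)
  note [measurable] = path_algebra_coordinate(1)[OF sets]
  note sp = path_algebra_coordinate(2)[OF sets]
  define A where "A n = {\<omega> \<in> space \<mu>. \<exists>q::rat. of_rat q \<in> ?O \<and> real n < \<bar>\<omega> (of_rat q)\<bar>}" for n
  have cont: "continuous_on UNIV \<omega>" if "\<omega> \<in> wiener_paths" for \<omega> :: "real \<Rightarrow> real"
    using that by (simp add: wiener_paths_def)
  have "(\<Inter>n. A n) = {}"
  proof (rule ccontr)
    assume "(\<Inter>n. A n) \<noteq> {}"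
    then obtain \<omega> where \<omega>: "\<And>n. \<omega> \<in> A n" by auto
    then have "\<omega> \<in> wiener_paths" using sp by (auto simp: A_def)
    then have "compact (\<omega> ` {a - 1..b + 1})"
      by (intro compact_continuous_image continuous_on_subset[OF cont]) auto
    from bounded_real[THEN iffD1, OF compact_imp_bounded[OF this]]
    obtain B where B: "\<forall>y\<in>\<omega> ` {a - 1..b + 1}. \<bar>y\<bar> \<le> B" by auto
    obtain n :: nat where n: "B < real n" using reals_Archimedean2 by blast
    from \<omega>[of n] obtain q :: rat where q: "of_rat q \<in> ?O" "real n < \<bar>\<omega> (of_rat q)\<bar>"
      by (auto simp: A_def)
    have "\<bar>\<omega> (of_rat q)\<bar> \<le> B" using B q(1) by auto
    with q n show False by linarith
  qed
  moreover have "A n \<in> sets \<mu>" for n unfolding A_def by measurable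
  moreover have "decseq A" unfolding decseq_def A_def by force
  ultimately obtain n where n: "emeasure \<mu> (A n) < r"
    using wiener_decreasing_events[OF W _ _ _ r, of A] by metis
  show thesis
  proof (rule that[of "A n" "real n"])
    show "A n \<in> sets \<mu>" unfolding A_def by measurable
    fix \<omega> s assume \<omega>: "\<omega> \<in> wiener_paths - A n" and s: "s \<in> {a..b}"
    show "\<bar>\<omega> s\<bar> \<le> real n"
    proof (rule ccontr)
      assume "\<not> \<bar>\<omega> s\<bar> \<le> real n"
      moreover have "open {s. real n < \<bar>\<omega> s\<bar>}"
        using \<omega> by (intro open_Collect_less continuous_intros cont) auto
      ultimately obtain q :: rat where "of_rat q \<in> ?O \<inter> {s. real n < \<bar>\<omega> s\<bar>}"
        using open_contains_rat[OF open_Int[OF open_greaterThanLessThan], of "{s. real n < \<bar>\<omega> s\<bar>}" s] s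
        by force
      then have "\<omega> \<in> A n" using \<omega> sp by (auto simp: A_def)
      with \<omega> show False by simp
    qed
  qed (rule n)
qed

text \<open>The scheme of \<open>wiener_bounded\<close> with pairs of times, uniform continuity on a
  compact interval emptying the intersection. All inequalities in \<open>?P\<close> are strict, so a
  violating pair has an open rectangle of violating pairs around it, hence a rational one.\<close>

lemma wiener_modulus:
  assumes W: "wiener_measure \<mu>" and r: "0 < (r::ennreal)" and \<eta>: "0 < \<eta>"
  obtains \<delta> A where "A \<in> sets \<mu>" "emeasure \<mu> A < r" "0 < \<delta>"
    "\<And>\<omega> s t. \<omega> \<in> wiener_paths - A \<Longrightarrow> s \<in> {a..b} \<Longrightarrow> t \<in> {a..b} \<Longrightarrow> \<bar>s - t\<bar> < \<delta> \<Longrightarrow> \<bar>\<omega> s - \<omega> t\<bar> \<le> \<eta>"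
proof -
  let ?O = "{a - 1<..<b + 1}"
  let ?P = "\<lambda>n \<omega> s t. s \<in> ?O \<and> t \<in> ?O \<and> \<bar>s - t\<bar> < 1 / real (Suc n) \<and> \<eta> < \<bar>\<omega> s - \<omega> t\<bar>"
  have sets: "sets \<mu> = sets (path_algebra wiener_paths)" using W by (simp add: wiener_measure_def)
  note [measurable] = path_algebra_coordinate(1)[OF sets]
  note sp = path_algebra_coordinate(2)[OF sets]
  define A where "A n = {\<omega> \<in> space \<mu>. \<exists>(p::rat) (q::rat). ?P n \<omega> (of_rat p) (of_rat q)}" for n
  have cont: "continuous_on UNIV \<omega>" if "\<omega> \<in> wiener_paths" for \<omega> :: "real \<Rightarrow> real"
    using that by (simp add: wiener_paths_def)
  have A_meas: "A n \<in> sets \<mu>" for n unfolding A_def by measurable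
  have emp: "(\<Inter>n. A n) = {}"
  proof (rule ccontr)
    assume "(\<Inter>n. A n) \<noteq> {}"
    then obtain \<omega> where \<omega>: "\<And>n. \<omega> \<in> A n" by auto
    then have "\<omega> \<in> wiener_paths" using sp by (auto simp: A_def)
    then have uc: "uniformly_continuous_on {a - 1..b + 1} \<omega>"
      by (intro compact_uniformly_continuous continuous_on_subset[OF cont]) auto
    obtain d where d: "0 < d" "\<forall>s\<in>{a - 1..b + 1}. \<forall>t\<in>{a - 1..b + 1}. dist t s < d \<longrightarrow> dist (\<omega> t) (\<omega> s) < \<eta>"
      using uc[unfolded uniformly_continuous_on_def, rule_format, OF \<eta>] by auto
    obtain n :: nat where n: "1 / real (Suc n) < d" using nat_approx_posE[OF d(1)] by (metis of_nat_Suc)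
    from \<omega>[of n] obtain p q :: rat where pq: "?P n \<omega> (of_rat p) (of_rat q)" by (auto simp: A_def)
    then have "dist (\<omega> (of_rat p)) (\<omega> (of_rat q)) < \<eta>"
      using n by (intro d(2)[rule_format]) (auto simp: dist_real_def)
    with pq show False by (simp add: dist_real_def)
  qed
  have dec: "decseq A"
  proof (rule decseq_SucI)
    fix n
    have "1 / real (Suc (Suc n)) \<le> 1 / real (Suc n)" by (simp add: field_simps)
    then have "?P n \<omega> s t" if "?P (Suc n) \<omega> s t" for s t and \<omega> :: "real \<Rightarrow> real"
      using that by (metis less_le_trans)
    then show "A (Suc n) \<subseteq> A n" unfolding A_def by blast
  qed
  obtain n where n: "emeasure \<mu> (A n) < r"
    by (rule wiener_decreasing_events[OF W A_meas dec emp r])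
  show thesis
  proof (rule that[of "A n" "1 / real (Suc n)"])
    fix \<omega> s t
    assume \<omega>: "\<omega> \<in> wiener_paths - A n" and st: "s \<in> {a..b}" "t \<in> {a..b}" "\<bar>s - t\<bar> < 1 / real (Suc n)"
    show "\<bar>\<omega> s - \<omega> t\<bar> \<le> \<eta>"
    proof (rule ccontr)
      assume neg: "\<not> \<bar>\<omega> s - \<omega> t\<bar> \<le> \<eta>"
      have c: "continuous_on UNIV (\<lambda>x. \<omega> (f x))" if "continuous_on UNIV f" for f :: "real \<times> real \<Rightarrow> real"
        using \<omega> cont by (intro continuous_on_compose2[OF _ that]) auto
      have op: "open {x. ?P n \<omega> (fst x) (snd x)}"
        by (simp only: greaterThanLessThan_iff)
           (intro open_Collect_conj open_Collect_less continuous_intros c)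
      have mem: "(s, t) \<in> {x. ?P n \<omega> (fst x) (snd x)}" using st neg by auto
      obtain U V where UV: "open U" "open V" "(s, t) \<in> U \<times> V" "U \<times> V \<subseteq> {x. ?P n \<omega> (fst x) (snd x)}"
        by (rule open_prod_elim[OF op mem])
      obtain p q :: rat where "of_rat p \<in> U" "of_rat q \<in> V"
        using open_contains_rat[OF UV(1)] open_contains_rat[OF UV(2)] UV(3) by blast
      then have "?P n \<omega> (of_rat p) (of_rat q)" using UV(4) by auto
      then have "\<omega> \<in> A n" using \<omega> sp unfolding A_def by blast
      with \<omega> show False by simp
    qed
  qed (use n A_meas in auto)
qed

section \<open>Convergence of the solutions\<close>

text \<open>Outer measure is monotone on arbitrary sets, so a pointwise comparison of the two
  quantities is enough.\<close>

lemma null_in_probability_mono: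
  assumes null: "null_in_probability P \<Omega> X"
    and le: "\<And>\<alpha> p. \<alpha> \<in> {1<..<2} \<Longrightarrow> p \<in> \<Omega> \<alpha> \<Longrightarrow> Y \<alpha> p \<le> X \<alpha> p"
  shows "null_in_probability P \<Omega> Y"
  unfolding null_in_probability_def
proof (intro allI impI)
  fix \<epsilon> :: real assume "0 < \<epsilon>"
  then have lim: "((\<lambda>\<alpha>. outer_measure_of (P \<alpha>) {p \<in> \<Omega> \<alpha>. X \<alpha> p > ennreal \<epsilon>}) \<longlongrightarrow> 0) (at_left 2)"
    using null by (simp add: null_in_probability_def)
  show "((\<lambda>\<alpha>. outer_measure_of (P \<alpha>) {p \<in> \<Omega> \<alpha>. Y \<alpha> p > ennreal \<epsilon>}) \<longlongrightarrow> 0) (at_left 2)"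
  proof (rule tendsto_sandwich[OF _ _ tendsto_const lim])
    show "eventually (\<lambda>\<alpha>. outer_measure_of (P \<alpha>) {p \<in> \<Omega> \<alpha>. Y \<alpha> p > ennreal \<epsilon>}
        \<le> outer_measure_of (P \<alpha>) {p \<in> \<Omega> \<alpha>. X \<alpha> p > ennreal \<epsilon>}) (at_left 2)"
      using eventually_at_left_2
      by eventually_elim (auto intro!: outer_measure_of_mono less_le_trans[OF _ le])
  qed simp
qed

text \<open>The identity is an admissible time change, and its slope term is ln 1 = 0.\<close>

lemma skorokhod_le_uniform:
  "skorokhod_dist e lam \<sigma> T \<phi> \<psi> \<le> uniform_dist e lam \<sigma> T \<phi> \<psi>"
proof -
  let ?slope = "\<lambda>h. SUP (s, t)\<in>{(s, t). s \<in> {0..T} \<and> t \<in> {0..T} \<and> s \<noteq> t}.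
           ennreal \<bar>ln ((h s - h t) / (s - t))\<bar>"
  have "id \<in> time_changes T"
    by (auto simp: time_changes_def strict_mono_on_def)
  then have "skorokhod_dist e lam \<sigma> T \<phi> \<psi> \<le> uniform_dist e lam \<sigma> T \<phi> \<psi> + ?slope id"
    unfolding skorokhod_dist_def uniform_dist_def by (rule INF_lower2) simp
  moreover have "?slope id \<le> 0" by (rule SUP_least) auto
  ultimately show ?thesis by (simp add: order_trans[OF _ eq_refl])
qed

lemma positive_discrete_spectrum_imp:
  fixes e :: "nat \<Rightarrow> 'h::{real_inner, banach, second_countable_topology}"
  assumes "positive_discrete_spectrum DA A e lam"
  shows "discrete_spectrum e lam"
proof
  show "e i \<bullet> e j = (if i = j then 1 else 0)" for i j
    using assms by (auto simp: positive_discrete_spectrum_def orthonormal_basis_def)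
  show "0 < lam k" for k
  proof -
    have "lam 0 \<le> lam k" "0 < lam 0"
      using assms by (auto simp: positive_discrete_spectrum_def incseqD)
    then show ?thesis by linarith
  qed
qed

text \<open>Each choice depends on the previous ones and none on \<alpha>: \<open>K\<close> from the
  size of Brownian paths, \<open>c\<close> from \<open>K\<close>, \<open>\<eta>\<close> from
  \<open>c\<close> and \<epsilon>, \<open>\<delta>\<close> from the modulus of continuity at
  \<open>\<eta>\<close>, and \<open>B\<close> from \<open>\<delta>\<close>. Only then does \<alpha>
  tend to 2, which makes \<open>B\<close> improbable.\<close>

theorem theorem3p1:
  fixes A F :: "'h::{real_inner, banach, second_countable_topology} \<Rightarrow> 'h"
    and DA :: "'h set" and e :: "nat \<Rightarrow> 'h" and lam :: "nat \<Rightarrow> real"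
    and \<sigma> L T :: real and x :: 'h
    and C :: "real \<Rightarrow> real"
    and \<mu>W :: "(real \<Rightarrow> real) measure" and \<mu>S :: "real \<Rightarrow> (real \<Rightarrow> real) measure"
    and P :: "real \<Rightarrow> ((real \<Rightarrow> real) \<times> (real \<Rightarrow> real)) measure"
    and \<Omega> :: "real \<Rightarrow> ((real \<Rightarrow> real) \<times> (real \<Rightarrow> real)) set"
    and v\<alpha> :: "real \<Rightarrow> (real \<Rightarrow> real) \<times> (real \<Rightarrow> real) \<Rightarrow> real \<Rightarrow> 'h"
    and v :: "(real \<Rightarrow> real) \<Rightarrow> real \<Rightarrow> 'h"
  assumes A: "positive_discrete_spectrum DA A e lam"
    and \<sigma>: "0 \<le> \<sigma>" "\<sigma> < 1"
    and F0: "F 0 = 0"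
    and L: "L > 0"
    and F_lipschitz: "\<And>u1 u2. u1 \<in> frac_dom e lam \<sigma> \<Longrightarrow> u2 \<in> frac_dom e lam \<sigma> \<Longrightarrow>
            norm (F u1 - F u2) \<le> L * frac_norm e lam \<sigma> (u1 - u2)"
    and C_pos: "\<And>\<alpha>. \<alpha> \<in> {1<..<2} \<Longrightarrow> C \<alpha> > 0"
    and C_lim: "((\<lambda>\<alpha>. 2 * C \<alpha> / (2 - \<alpha>)) \<longlongrightarrow> 1) (at_left 2)"
    and W: "wiener_measure \<mu>W"
    and S: "\<And>\<alpha>. \<alpha> \<in> {1<..<2} \<Longrightarrow> stable_subordinator_measure (\<alpha> / 2) (C \<alpha>) (\<mu>S \<alpha>)"
    and P: "\<And>\<alpha>. \<alpha> \<in> {1<..<2} \<Longrightarrow> P \<alpha> = \<mu>W \<Otimes>\<^sub>M \<mu>S \<alpha>"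
    and \<Omega>_sublinear: "\<And>\<alpha>. \<alpha> \<in> {1<..<2} \<Longrightarrow> \<Omega> \<alpha> \<subseteq> sublinear_paths"
    and \<Omega>_full: "\<And>\<alpha>. \<alpha> \<in> {1<..<2} \<Longrightarrow> AE p in P \<alpha>. p \<in> \<Omega> \<alpha>"
    and x: "x \<in> frac_dom e lam \<sigma>"
    and T: "T > 0"
    and v\<alpha>: "\<And>\<alpha> \<omega> ell. \<alpha> \<in> {1<..<2} \<Longrightarrow> (\<omega>, ell) \<in> \<Omega> \<alpha> \<Longrightarrow>
            sde_solution e lam \<sigma> F (\<omega> \<circ> ell) x (v\<alpha> \<alpha> (\<omega>, ell))"
    and v: "\<And>\<alpha> \<omega> ell. \<alpha> \<in> {1<..<2} \<Longrightarrow> (\<omega>, ell) \<in> \<Omega> \<alpha> \<Longrightarrow>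
            sde_solution e lam \<sigma> F \<omega> x (v \<omega>)"
  shows "null_in_probability P \<Omega>
           (\<lambda>\<alpha> (\<omega>, ell). SUP t\<in>{0..T}. ennreal (frac_norm e lam \<sigma> (v\<alpha> \<alpha> (\<omega>, ell) t - v \<omega> t)))
       \<and> (\<forall>\<alpha>\<in>{1<..<2}. \<forall>(\<omega>, ell)\<in>\<Omega> \<alpha>.
           v\<alpha> \<alpha> (\<omega>, ell) \<in> cadlag_space e lam \<sigma> T \<and> v \<omega> \<in> cadlag_space e lam \<sigma> T)
       \<and> null_in_probability P \<Omega>
           (\<lambda>\<alpha> (\<omega>, ell). uniform_dist e lam \<sigma> T (v\<alpha> \<alpha> (\<omega>, ell)) (v \<omega>))
       \<and> null_in_probability P \<Omega>
           (\<lambda>\<alpha> (\<omega>, ell). skorokhod_dist e lam \<sigma> T (v\<alpha> \<alpha> (\<omega>, ell)) (v \<omega>))"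
proof -
  interpret discrete_spectrum e lam by (rule positive_discrete_spectrum_imp[OF A])
  have paths: "\<omega> \<in> wiener_paths \<and> ell \<in> subordinator_paths \<and> driving_path (\<omega> \<circ> ell) \<and> driving_path \<omega>"
    if "\<alpha> \<in> {1<..<2}" "(\<omega>, ell) \<in> \<Omega> \<alpha>" for \<alpha> \<omega> ell
  proof -
    have *: "(\<omega>, ell) \<in> sublinear_paths" using \<Omega>_sublinear[OF that(1)] that(2) by blast
    then have "driving_path (\<omega> \<circ> ell)" "driving_path (\<omega> \<circ> id)"
      by (intro driving_path_comp id_subordinator; simp add: sublinear_paths_def)+
    with * show ?thesis by (auto simp: sublinear_paths_def)
  qed
  have sols: "duhamel_solution \<sigma> F T (\<omega> \<circ> ell) x (v\<alpha> \<alpha> (\<omega>, ell))" "duhamel_solution \<sigma> F T \<omega> x (v \<omega>)"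
      "v\<alpha> \<alpha> (\<omega>, ell) \<in> cadlag_space e lam \<sigma> T" "v \<omega> \<in> cadlag_space e lam \<sigma> T"
    if "\<alpha> \<in> {1<..<2}" "(\<omega>, ell) \<in> \<Omega> \<alpha>" for \<alpha> \<omega> ell
    using sde_solution_duhamel[OF F_lipschitz _ v\<alpha>[OF that]] sde_solution_duhamel[OF F_lipschitz _ v[OF that]]
      paths[OF that] by auto
  let ?X = "\<lambda>\<alpha> (\<omega>, ell). SUP t\<in>{0..T}. ennreal (frac_norm e lam \<sigma> (v\<alpha> \<alpha> (\<omega>, ell) t - v \<omega> t))"
  have null: "null_in_probability P \<Omega> ?X"
    unfolding null_in_probability_def
  proof (intro allI impI order_tendstoI)
    fix \<epsilon> :: real and a :: ennreal
    assume \<epsilon>: "0 < \<epsilon>" and a: "0 < a"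
    \<comment> \<open>As \<open>a\<close> may be infinite, a finite level below it is divided into
      equal shares for the three exceptional events.\<close>
    obtain y where y: "0 < y" "y < a" using dense[OF a] by blast
    then have "y \<noteq> top" by (auto simp: top.not_eq_extremum intro: less_le_trans)
    then obtain z where z: "y = ennreal z" "0 \<le> z" by (cases y) auto
    define r where "r = ennreal (z / 3)"
    have z0: "0 < z" using y z by (simp add: ennreal_less_zero_iff)
    then have r: "0 < r" by (simp add: r_def)
    have "r + r + r = y" unfolding r_def z(1) using z0 by (simp flip: ennreal_plus)
    with y have rrr: "r + r + r < a" by simp
    obtain K A1 where A1: "A1 \<in> sets \<mu>W" "emeasure \<mu>W A1 < r"
        "\<And>\<omega> s. \<omega> \<in> wiener_paths - A1 \<Longrightarrow> s \<in> {0..T + 1} \<Longrightarrow> \<bar>\<omega> s\<bar> \<le> K"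
      by (rule wiener_bounded[OF W r, of 0 "T + 1"]) (rule that)
    obtain c where c: "0 \<le> c"
      and stable: "\<And>\<xi>1 \<xi>2 \<eta> V1 V2 t. \<xi>1 \<in> borel_measurable borel \<Longrightarrow> \<xi>2 \<in> borel_measurable borel \<Longrightarrow>
      duhamel_solution \<sigma> F T \<xi>1 x V1 \<Longrightarrow> duhamel_solution \<sigma> F T \<xi>2 x V2 \<Longrightarrow>
      \<forall>t\<in>{0..T}. \<bar>\<xi>1 t\<bar> \<le> K \<and> \<bar>\<xi>2 t\<bar> \<le> K \<and> \<bar>\<xi>1 t - \<xi>2 t\<bar> \<le> \<eta> \<Longrightarrow>
      t \<in> {0..T} \<Longrightarrow> frac_norm e lam \<sigma> (V1 t - V2 t) \<le> c * \<eta>"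
      by (rule duhamel_stability[where F = F, OF \<sigma> less_imp_le[OF L] F0 _ x, of T K]) (erule (1) F_lipschitz, rule that)
    \<comment> \<open>The summand 1 covers c = 0.\<close>
    define \<eta> where "\<eta> = \<epsilon> / (c + 1)"
    have \<eta>: "0 < \<eta>" using \<epsilon> c by (simp add: \<eta>_def)
    have c\<eta>: "c * \<eta> \<le> \<epsilon>" using \<epsilon> c by (simp add: \<eta>_def field_simps)
    obtain \<delta> A2 where A2: "A2 \<in> sets \<mu>W" "emeasure \<mu>W A2 < r" "0 < \<delta>"
        "\<And>\<omega> s t. \<omega> \<in> wiener_paths - A2 \<Longrightarrow> s \<in> {0..T + 1} \<Longrightarrow> t \<in> {0..T + 1} \<Longrightarrow>
          \<bar>s - t\<bar> < \<delta> \<Longrightarrow> \<bar>\<omega> s - \<omega> t\<bar> \<le> \<eta>"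
      by (rule wiener_modulus[OF W r \<eta>, of 0 "T + 1"]) (rule that)
    \<comment> \<open>The bound \<open>\<delta>\<close> serves the modulus of continuity; the bound
      1 keeps \<open>ell t\<close> in the window [0, T + 1] on which \<omega> is controlled.\<close>
    have \<delta>: "0 < min \<delta> 1" using A2 by simp
    obtain B where B: "\<And>\<alpha>. \<alpha> \<in> {1<..<2} \<Longrightarrow> B \<in> sets (\<mu>S \<alpha>)"
      "((\<lambda>\<alpha>. emeasure (\<mu>S \<alpha>) B) \<longlongrightarrow> 0) (at_left 2)"
      "\<And>ell t. ell \<in> subordinator_paths - B \<Longrightarrow> t \<in> {0..T} \<Longrightarrow> \<bar>ell t - t\<bar> < min \<delta> 1"
      by (rule subordinator_uniform[OF C_pos C_lim S T \<delta>]) (assumption, assumption, rule that)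
    have close: "frac_norm e lam \<sigma> (v\<alpha> \<alpha> (\<omega>, ell) t - v \<omega> t) \<le> \<epsilon>"
      if \<alpha>: "\<alpha> \<in> {1<..<2}" and p: "(\<omega>, ell) \<in> \<Omega> \<alpha>" and good: "\<omega> \<notin> A1" "\<omega> \<notin> A2" "ell \<notin> B"
        and t: "t \<in> {0..T}" for \<alpha> \<omega> ell t
    proof -
      have ell: "mono ell" "ell 0 = 0"
        using paths[OF \<alpha> p] subordinator_at_0[of ell] by (auto simp: subordinator_paths_def)
      have "\<bar>(\<omega> \<circ> ell) t\<bar> \<le> K \<and> \<bar>\<omega> t\<bar> \<le> K \<and> \<bar>(\<omega> \<circ> ell) t - \<omega> t\<bar> \<le> \<eta>" if t: "t \<in> {0..T}" for t
      proof -
        have dist: "\<bar>ell t - t\<bar> < min \<delta> 1" using B(3)[OF _ t] paths[OF \<alpha> p] good by auto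
        have "0 \<le> ell t" using monoD[OF ell(1), of 0 t] ell(2) t by simp
        with dist t have range: "ell t \<in> {0..T + 1}" "t \<in> {0..T + 1}" by auto
        show ?thesis
          using A1(3)[OF _ range(1)] A1(3)[OF _ range(2)] A2(4)[OF _ range] dist paths[OF \<alpha> p] good by auto
      qed
      then have "frac_norm e lam \<sigma> (v\<alpha> \<alpha> (\<omega>, ell) t - v \<omega> t) \<le> c * \<eta>"
        using paths[OF \<alpha> p]
        by (intro stable[OF _ _ sols(1)[OF \<alpha> p] sols(2)[OF \<alpha> p] _ t]) (auto simp: driving_path_def)
      with c\<eta> show ?thesis by linarith
    qed
    have "eventually (\<lambda>\<alpha>. emeasure (\<mu>S \<alpha>) B < r) (at_left 2)"
      using order_tendstoD(2)[OF B(2) r] .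
    with eventually_at_left_2
    show "eventually (\<lambda>\<alpha>. outer_measure_of (P \<alpha>) {p \<in> \<Omega> \<alpha>. ?X \<alpha> p > ennreal \<epsilon>} < a) (at_left 2)"
    proof eventually_elim
      case (elim \<alpha>)
      interpret MW: prob_space \<mu>W using W by (simp add: wiener_measure_def)
      interpret MS: prob_space "\<mu>S \<alpha>"
        using S[OF elim(1)] by (simp add: stable_subordinator_measure_def)
      have spW: "space \<mu>W = wiener_paths"
        using W by (intro path_algebra_coordinate) (simp add: wiener_measure_def)
      have spS: "space (\<mu>S \<alpha>) = subordinator_paths"
        using S[OF elim(1)] by (intro path_algebra_coordinate) (simp add: stable_subordinator_measure_def)
      note [measurable] = A1(1) A2(1) B(1)[OF elim(1)]
      let ?Y1 = "(A1 \<union> A2) \<times> space (\<mu>S \<alpha>)" and ?Y2 = "space \<mu>W \<times> B"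
      have Y: "?Y1 \<in> sets (P \<alpha>)" "?Y2 \<in> sets (P \<alpha>)" unfolding P[OF elim(1)] by measurable
      \<comment> \<open>The event on the left need not be measurable; this cover by measurable
        rectangles bounds its outer measure.\<close>
      have "{p \<in> \<Omega> \<alpha>. ?X \<alpha> p > ennreal \<epsilon>} \<subseteq> ?Y1 \<union> ?Y2"
      proof
        fix p assume p: "p \<in> {p \<in> \<Omega> \<alpha>. ?X \<alpha> p > ennreal \<epsilon>}"
        obtain \<omega> ell where p_eq: "p = (\<omega>, ell)" by (cases p)
        have p\<Omega>: "(\<omega>, ell) \<in> \<Omega> \<alpha>" using p p_eq by simp
        have "\<not> (\<omega> \<notin> A1 \<and> \<omega> \<notin> A2 \<and> ell \<notin> B)"
        proof
          assume "\<omega> \<notin> A1 \<and> \<omega> \<notin> A2 \<and> ell \<notin> B"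
          then have "?X \<alpha> p \<le> ennreal \<epsilon>"
            unfolding p_eq using close[OF elim(1) p\<Omega>] by (auto intro!: SUP_least ennreal_leI)
          from leD[OF this] p show False by blast
        qed
        then show "p \<in> ?Y1 \<union> ?Y2" using paths[OF elim(1) p\<Omega>] spW spS p_eq by auto
      qed
      then have "outer_measure_of (P \<alpha>) {p \<in> \<Omega> \<alpha>. ?X \<alpha> p > ennreal \<epsilon>} \<le> emeasure (P \<alpha>) (?Y1 \<union> ?Y2)"
        unfolding outer_measure_of_def using Y by (intro INF_lower) auto
      also have "\<dots> \<le> emeasure (P \<alpha>) ?Y1 + emeasure (P \<alpha>) ?Y2"
        by (rule emeasure_subadditive[OF Y])
      also have "emeasure (P \<alpha>) ?Y1 = emeasure \<mu>W (A1 \<union> A2)"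
        unfolding P[OF elim(1)] by (subst MS.emeasure_pair_measure_Times) (auto simp: MS.emeasure_space_1)
      also have "emeasure (P \<alpha>) ?Y2 = emeasure (\<mu>S \<alpha>) B"
        unfolding P[OF elim(1)] by (subst MS.emeasure_pair_measure_Times) (auto simp: MW.emeasure_space_1)
      also have "emeasure \<mu>W (A1 \<union> A2) \<le> emeasure \<mu>W A1 + emeasure \<mu>W A2"
        by (rule emeasure_subadditive) (rule A1 A2)+
      also have "emeasure \<mu>W A1 + emeasure \<mu>W A2 + emeasure (\<mu>S \<alpha>) B \<le> r + r + r"
        using A1(2) A2(2) elim(2) by (intro add_mono) auto
      finally show ?case using rrr by (simp add: add_right_mono)
    qed
  qed simp
  have unif: "null_in_probability P \<Omega> (\<lambda>\<alpha> (\<omega>, ell). uniform_dist e lam \<sigma> T (v\<alpha> \<alpha> (\<omega>, ell)) (v \<omega>))"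
    unfolding uniform_dist_def by (rule null)
  have "null_in_probability P \<Omega> (\<lambda>\<alpha> (\<omega>, ell). skorokhod_dist e lam \<sigma> T (v\<alpha> \<alpha> (\<omega>, ell)) (v \<omega>))"
    by (rule null_in_probability_mono[OF unif]) (auto intro: skorokhod_le_uniform)
  with null unif sols(3,4) show ?thesis by blast
qed

end
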